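(* Assume (A1)–(A4) of the context, and let $$\eta_y=\frac{\sqrt{1-\lambda^2}}{9(L+\mu)},\qquad \eta_x=\frac1\gamma,\qquad \gamma=\frac{120\sqrt3\,\kappa L}{(1-\lambda^2)^2}+\frac{72\sqrt6\,\kappa^2(L+\mu)}{\sqrt{1-\lambda^2}}+\frac{110\kappa^{5/4}L}{(1-\lambda^2)^{9/8}}.$$ Let $\Delta_\Phi:=\Phi(\bar x^0)-\Phi^*$. Then for every integer $T\ge1$ the iterates of the DGTA method satisfy $$\frac1T\sum_{t=0}^{T-1}\|\nabla\Phi(\bar x^t)\|^2\le\frac{2\Delta_\Phi}{\eta_xT}+\frac{600\kappa^2L^2\|\mathbf x^0-\mathbf 1(\bar x^0)^\top\|^2}{n(1-\lambda^2)T}+\frac{16D^2L^2}{\eta_y\mu T}+\frac{4800\eta_x^2\kappa^2L^2\sum_{i=1}^n\|\nabla_xf_i(x_i^0,y_i^0)\|^2}{n(1-\lambda^2)^3T}.$$ In particular, there is an absolute numerical constant $C>0$ (independent of all problem data and of $T$) such that $$\frac1T\sum_{t=0}^{T-1}\|\nabla\Phi(\bar x^t)\|^2\le C\left(\frac{\Delta_\Phi\kappa L}{(1-\lambda)^2T}+\frac{\Delta_\Phi\kappa^2L}{\sqrt{1-\lambda}\,T}+\frac{\Delta_\Phi\kappa^{5/4}L}{(1-\lambda)^{9/8}T}+\frac{\kappa D^2L^2}{\sqrt{1-\lambda}\,T}+\frac{\kappa^2L^2\|\mathbf x^0-\mathbf 1(\bar x^0)^\top\|^2}{n(1-\lamb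da)T}+\frac{\sum_{i=1}^n\|\nabla_xf_i(x_i^0,y_i^0)\|^2}{nT}\right).$$
   Context: Setting: $n$ agents $\mathcal N=\{1,\dots,n\}$; agent $i$ has a differentiable function $f_i:\mathbb{R}^d\times\mathcal Y_i\to\mathbb{R}$, where $\mathcal Y_i$ is a subset of a Euclidean space (possibly of agent-dependent dimension). $\Phi_i(x):=\max_{y\in\mathcal Y_i}f_i(x,y)$ and $\Phi:=\frac1n\sum_{i=1}^n\Phi_i$ (a differentiable function under the assumptions below). Norms are Euclidean for vectors and Frobenius for matrices; $\mathbf 1\in\mathbb R^n$ is the all-ones vector. Assumptions. (A1) The agents are connected by an undirected connected graph with edge set $\mathcal E$, with $(i,i)\in\mathcal E$ for all $i$; $\mathcal N_i=\{j:(i,j)\in\mathcal E\}$. The mixing matrix $W=[w_{ij}]\in\mathbb{R}^{n\times n}$ is nonnegative, symmetric, $W\mathbf 1=\mathbf 1$, and for $i\ne j$ one has $w_{ij}=w_{ji}>0$ if $i,j$ are linked and $w_{ij}=w_{ji}=0$ otherwise. $\lambda$ denotes the spectral norm of $W-\mathbf 1\mathbf 1^\top/n$; the assumption is regarded as guaranteeing $\lambda<1$. (A2) Each $f_i$ is $L$-smooth: $\|\nabla f_i(x,y)-\nabla f_i(x',y')\|\le L(\|x-x'\|+\|y-y'\|)$ for all $(x,y),(x',y')\in\mathbb{R}^d\times\mathcal Y_i$; and $\mu$-strongly concave in $y$: $f_i(x,y)\le f_i(x,y')+\langle\nabla_yf_i(x,y'),y-y'\rangle-\frac\mu2\|y-y'\|^2$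 for all $x\in\mathbb{R}^d$, $y,y'\in\mathcal Y_i$. $\kappa:=L/\mu$. (A3) Each $\mathcal Y_i$ is (nonempty) convex and compact with diameter $D>0$. (A4) $\Phi(x)\ge\Phi^*>-\infty$ for all $x$. DGTA algorithm (full gradients, stepsizes $\eta_x,\eta_y$, initial points $x_i^0\in\mathbb{R}^d$, $y_i^0\in\mathcal Y_i$): initialize $g_i^0=\nabla_xf_i(x_i^0,y_i^0)$. For $t=0,1,2,\dots$, each agent $i$ computes $x_i^{t+1}=\sum_{j\in\mathcal N_i}w_{ij}(x_j^t-\eta_xg_j^t)$; $y_i^{t+1}=\mathrm{Proj}_{\mathcal Y_i}(y_i^t+\eta_y\nabla_yf_i(x_i^t,y_i^t))$; $g_i^{t+1}=\sum_{j\in\mathcal N_i}w_{ij}\big(g_j^t+\nabla_xf_j(x_j^{t+1},y_j^{t+1})-\nabla_xf_j(x_j^t,y_j^t)\big)$. Notation: $\mathbf x^t=[x_1^t,\dots,x_n^t]^\top\in\mathbb{R}^{n\times d}$ and $\bar x^t=\frac1n\sum_ix_i^t$. *)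

theory Defs
  imports "HOL-Analysis.Analysis"
begin

(* The constant C of the theorem must not depend on any dimension, and types cannot be
   quantified over below an existential.  So all the spaces R^m live in one type: finitely
   supported real sequences with the Euclidean inner product; R^m is the subspace of those
   supported on {..<m}. *)

typedef fvec = "{v :: nat \<Rightarrow> real. finite {k. v k \<noteq> 0}}"
  morphisms coord Fvec
  by (rule exI[of _ "\<lambda>_. 0"]) simp

lemma finite_coord: "finite {k. coord v k \<noteq> 0}"
  using coord[of v] by simp

lemma coord_Fvec: "finite {k. v k \<noteq> 0} \<Longrightarrow> coord (Fvec v) = v"
  by (simp add: Fvec_inverse)

lemma fvec_eqI: "(\<And>k. coord u k = coord v k) \<Longrightarrow> u = v"
proof -
  assume "\<And>k. coord u k = coord v k"
  then have "coord u = coord v" by (rule ext)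
  then show "u = v" by (simp add: coord_inject)
qed

instantiation fvec :: real_vector
begin

definition zero_fvec :: fvec where "0 = Fvec (\<lambda>_. 0)"
definition plus_fvec :: "fvec \<Rightarrow> fvec \<Rightarrow> fvec" where
  "u + v = Fvec (\<lambda>k. coord u k + coord v k)"
definition minus_fvec :: "fvec \<Rightarrow> fvec \<Rightarrow> fvec" where
  "u - v = Fvec (\<lambda>k. coord u k - coord v k)"
definition uminus_fvec :: "fvec \<Rightarrow> fvec" where
  "- u = Fvec (\<lambda>k. - coord u k)"
definition scaleR_fvec :: "real \<Rightarrow> fvec \<Rightarrow> fvec" where
  "r *\<^sub>R u = Fvec (\<lambda>k. r * coord u k)"

lemma coord_zero [simp]: "coord 0 k = 0"
  by (simp add: zero_fvec_def coord_Fvec)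

lemma coord_plus [simp]: "coord (u + v) k = coord u k + coord v k"
proof -
  have "finite {k. coord u k + coord v k \<noteq> 0}"
    by (rule finite_subset[OF _ finite_UnI[OF finite_coord[of u] finite_coord[of v]]]) auto
  then show ?thesis by (simp add: plus_fvec_def coord_Fvec)
qed

lemma coord_minus [simp]: "coord (u - v) k = coord u k - coord v k"
proof -
  have "finite {k. coord u k - coord v k \<noteq> 0}"
    by (rule finite_subset[OF _ finite_UnI[OF finite_coord[of u] finite_coord[of v]]]) auto
  then show ?thesis by (simp add: minus_fvec_def coord_Fvec)
qed

lemma coord_uminus [simp]: "coord (- u) k = - coord u k"
  by (simp add: uminus_fvec_def coord_Fvec finite_coord)

lemma coord_scaleR [simp]: "coord (r *\<^sub>R u) k = r * coord u k"
proof -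
  have "finite {k. r * coord u k \<noteq> 0}"
    by (rule finite_subset[OF _ finite_coord[of u]]) auto
  then show ?thesis by (simp add: scaleR_fvec_def coord_Fvec)
qed

instance
  by (intro_classes; rule fvec_eqI; simp add: algebra_simps)

end

instantiation fvec :: real_inner
begin

definition inner_fvec :: "fvec \<Rightarrow> fvec \<Rightarrow> real" where
  "inner_fvec u v = (\<Sum>k | coord u k \<noteq> 0. coord u k * coord v k)"
definition norm_fvec :: "fvec \<Rightarrow> real" where "norm_fvec u = sqrt (inner u u)"
definition sgn_fvec :: "fvec \<Rightarrow> fvec" where "sgn_fvec u = inverse (norm u) *\<^sub>R u"
definition dist_fvec :: "fvec \<Rightarrow> fvec \<Rightarrow> real" where "dist_fvec u v = norm (u - v)"
definition uniformity_fvec :: "(fvec \<times> fvec) filter" where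
  "uniformity_fvec = (INF e\<in>{0<..}. principal {(x, y). dist x y < e})"
definition open_fvec :: "fvec set \<Rightarrow> bool" where
  "open_fvec U \<longleftrightarrow> (\<forall>x\<in>U. eventually (\<lambda>(x', y). x' = x \<longrightarrow> y \<in> U) uniformity)"

lemma inner_fvec_eq:
  assumes "finite K" "{k. coord u k \<noteq> 0} \<subseteq> K"
  shows "inner u v = (\<Sum>k\<in>K. coord u k * coord v k)"
  unfolding inner_fvec_def using assms by (intro sum.mono_neutral_left) auto

instance
proof
  fix x y z :: fvec and r :: real
  define K where "K = {k. coord x k \<noteq> 0} \<union> {k. coord y k \<noteq> 0} \<union> {k. coord z k \<noteq> 0}"
  have fin: "finite K" unfolding K_def by (intro finite_UnI finite_coord)
  have ix: "inner x v = (\<Sum>k\<in>K. coord x k * coord v k)" for v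
    by (rule inner_fvec_eq[OF fin]) (auto simp: K_def)
  have iy: "inner y v = (\<Sum>k\<in>K. coord y k * coord v k)" for v
    by (rule inner_fvec_eq[OF fin]) (auto simp: K_def)
  show "inner x y = inner y x" unfolding ix iy by (simp only: mult.commute)
  have "inner (x + y) z = (\<Sum>k\<in>K. coord (x + y) k * coord z k)"
    by (rule inner_fvec_eq[OF fin]) (auto simp: K_def)
  then show "inner (x + y) z = inner x z + inner y z"
    by (simp only: ix iy coord_plus distrib_right sum.distrib)
  have "inner (r *\<^sub>R x) y = (\<Sum>k\<in>K. coord (r *\<^sub>R x) k * coord y k)"
    by (rule inner_fvec_eq[OF fin]) (auto simp: K_def)
  then show "inner (r *\<^sub>R x) y = r * inner x y"
    by (simp only: ix coord_scaleR sum_distrib_left mult.assoc)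
  show "0 \<le> inner x x" unfolding ix by (intro sum_nonneg) simp
  show "inner x x = 0 \<longleftrightarrow> x = 0"
  proof
    assume "inner x x = 0"
    then have "(\<Sum>k\<in>K. coord x k * coord x k) = 0" by (simp only: ix)
    then have sq: "coord x k * coord x k = 0" if "k \<in> K" for k
      using sum_nonneg_eq_0_iff[OF fin, of "\<lambda>k. coord x k * coord x k"] that by simp
    show "x = 0"
    proof (rule fvec_eqI)
      fix k
      show "coord x k = coord 0 k"
      proof (cases "coord x k = 0")
        case False
        then have "k \<in> K" by (simp add: K_def)
        from sq[OF this] show ?thesis by simp
      qed simp
    qed
  next
    assume "x = 0"
    then show "inner x x = 0" by (simp add: inner_fvec_def)
  qed
  show "norm x = sqrt (inner x x)" by (rule norm_fvec_def)
  show "sgn x = inverse (norm x) *\<^sub>R x" by (rule sgn_fvec_def)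
  show "dist x y = norm (x - y)" by (rule dist_fvec_def)
next
  show "uniformity = (INF e\<in>{0<..}. principal {(x, y :: fvec). dist x y < e})"
    by (rule uniformity_fvec_def)
next
  fix U :: "fvec set"
  show "open U \<longleftrightarrow> (\<forall>x\<in>U. \<forall>\<^sub>F (x', y) in uniformity. x' = x \<longrightarrow> y \<in> U)"
    by (rule open_fvec_def)
qed

end

definition euclid :: "nat \<Rightarrow> fvec set" where
  "euclid m = {v. \<forall>k\<ge>m. coord v k = 0}"

(* For x in a linear subspace S there is at most one such v. *)
definition gradient_on :: "fvec set \<Rightarrow> (fvec \<Rightarrow> real) \<Rightarrow> fvec \<Rightarrow> fvec" where
  "gradient_on S F x =
     (THE v. v \<in> S \<and> (F has_derivative (\<lambda>h. v \<bullet> h)) (at x within S))"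

(* closest_point of the library is restricted to Heine-Borel spaces. *)
definition proj :: "'a::metric_space set \<Rightarrow> 'a \<Rightarrow> 'a" where
  "proj S a = (SOME y. y \<in> S \<and> (\<forall>z\<in>S. dist a y \<le> dist a z))"

definition avg :: "nat \<Rightarrow> (nat \<Rightarrow> 'a::real_vector) \<Rightarrow> 'a" where
  "avg n x = (1 / real n) *\<^sub>R (\<Sum>i<n. x i)"

(* Frobenius norm of the matrix with rows X 0, ..., X (n - 1). *)
definition frob_norm :: "nat \<Rightarrow> (nat \<Rightarrow> 'a::real_normed_vector) \<Rightarrow> real" where
  "frob_norm n X = sqrt (\<Sum>i<n. (norm (X i))\<^sup>2)"

definition mat_apply :: "nat \<Rightarrow> (nat \<Rightarrow> nat \<Rightarrow> real) \<Rightarrow> fvec \<Rightarrow> fvec" where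
  "mat_apply n A v = Fvec (\<lambda>i. if i < n then \<Sum>j<n. A i j * coord v j else 0)"

definition spectral_norm :: "nat \<Rightarrow> (nat \<Rightarrow> nat \<Rightarrow> real) \<Rightarrow> real" where
  "spectral_norm n A = onorm (mat_apply n A)"

(* Agents are numbered 0, ..., n - 1. *)

definition connected_graph :: "nat \<Rightarrow> (nat \<times> nat) set \<Rightarrow> bool" where
  "connected_graph n E \<longleftrightarrow>
     E \<subseteq> {..<n} \<times> {..<n} \<and> sym E \<and> (\<forall>i<n. (i, i) \<in> E) \<and>
     (\<forall>i<n. \<forall>j<n. (i, j) \<in> E\<^sup>*)"

definition mixing_matrix ::
    "nat \<Rightarrow> (nat \<times> nat) set \<Rightarrow> (nat \<Rightarrow> nat \<Rightarrow> real) \<Rightarrow> bool" where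
  "mixing_matrix n E W \<longleftrightarrow>
     (\<forall>i<n. \<forall>j<n. 0 \<le> W i j \<and> W i j = W j i) \<and>
     (\<forall>i<n. (\<Sum>j<n. W i j) = 1) \<and>
     (\<forall>i<n. \<forall>j<n. i \<noteq> j \<longrightarrow> (if (i, j) \<in> E then W i j > 0 else W i j = 0))"

(* G is the gradient of F on R^d \<times> Y, Y a subset of R^m.  If Y has empty interior in R^m,
   the y-component of the gradient is not determined by F on R^d \<times> Y; then any choice is
   allowed, in particular the gradient of a differentiable extension of F. *)
definition is_gradient ::
    "nat \<Rightarrow> nat \<Rightarrow> fvec set \<Rightarrow> (fvec \<times> fvec \<Rightarrow> real) \<Rightarrow> (fvec \<times> fvec \<Rightarrow> fvec \<times> fvec) \<Rightarrow> bool"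
  where
  "is_gradient d m Y F G \<longleftrightarrow>
     (\<forall>z \<in> euclid d \<times> Y. G z \<in> euclid d \<times> euclid m \<and>
        (F has_derivative (\<lambda>h. G z \<bullet> h)) (at z within euclid d \<times> Y))"

definition smooth_grad ::
    "nat \<Rightarrow> fvec set \<Rightarrow> real \<Rightarrow> (fvec \<times> fvec \<Rightarrow> fvec \<times> fvec) \<Rightarrow> bool" where
  "smooth_grad d Y L G \<longleftrightarrow>
     (\<forall>x\<in>euclid d. \<forall>x'\<in>euclid d. \<forall>y\<in>Y. \<forall>y'\<in>Y.
        norm (G (x, y) - G (x', y')) \<le> L * (norm (x - x') + norm (y - y')))"

definition strongly_concave_y ::
    "nat \<Rightarrow> fvec set \<Rightarrow> real \<Rightarrow> (fvec \<times> fvec \<Rightarrow> real) \<Rightarrow> (fvec \<times> fvec \<Rightarrow> fvec \<times> fvec) \<Rightarrow> bool"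
  where
  "strongly_concave_y d Y \<mu> F G \<longleftrightarrow>
     (\<forall>x\<in>euclid d. \<forall>y\<in>Y. \<forall>y'\<in>Y.
        F (x, y) \<le> F (x, y') + snd (G (x, y')) \<bullet> (y - y') - \<mu> / 2 * (norm (y - y'))\<^sup>2)"

definition Phi ::
    "nat \<Rightarrow> (nat \<Rightarrow> fvec \<times> fvec \<Rightarrow> real) \<Rightarrow> (nat \<Rightarrow> fvec set) \<Rightarrow> fvec \<Rightarrow> real" where
  "Phi n f Y x = (1 / real n) * (\<Sum>i<n. SUP y\<in>Y i. f i (x, y))"

(* Iterates (x, y, g); the neighbourhood of agent i is E `` {i}. *)
primrec dgta ::
    "(nat \<times> nat) set \<Rightarrow> (nat \<Rightarrow> nat \<Rightarrow> real) \<Rightarrow> (nat \<Rightarrow> fvec set) \<Rightarrow>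
     (nat \<Rightarrow> fvec \<times> fvec \<Rightarrow> fvec \<times> fvec) \<Rightarrow> real \<Rightarrow> real \<Rightarrow>
     (nat \<Rightarrow> fvec) \<Rightarrow> (nat \<Rightarrow> fvec) \<Rightarrow> nat \<Rightarrow>
     (nat \<Rightarrow> fvec) \<times> (nat \<Rightarrow> fvec) \<times> (nat \<Rightarrow> fvec)" where
  "dgta E W Y G \<eta>x \<eta>y x0 y0 0 = (x0, y0, \<lambda>i. fst (G i (x0 i, y0 i)))"
| "dgta E W Y G \<eta>x \<eta>y x0 y0 (Suc t) =
     (let (x, y, g) = dgta E W Y G \<eta>x \<eta>y x0 y0 t;
          x' = (\<lambda>i. \<Sum>j\<in>E `` {i}. W i j *\<^sub>R (x j - \<eta>x *\<^sub>R g j));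
          y' = (\<lambda>i. proj (Y i) (y i + \<eta>y *\<^sub>R snd (G i (x i, y i))));
          g' = (\<lambda>i. \<Sum>j\<in>E `` {i}.
                 W i j *\<^sub>R (g j + fst (G j (x' j, y' j)) - fst (G j (x j, y j))))
      in (x', y', g'))"

definition dgta_x where
  "dgta_x E W Y G \<eta>x \<eta>y x0 y0 t = fst (dgta E W Y G \<eta>x \<eta>y x0 y0 t)"

end

theory Submission
  imports Defs
begin

text \<open>
  Write \<open>q\<close>, \<open>r\<close>, \<open>\<delta>\<close> for the squared Frobenius distances of the iterates \<open>x\<close> to their mean,
  of the trackers \<open>g\<close> to their mean, and of the \<open>y i\<close> to the maximisers at the mean point, and
  \<open>s\<close> for the squared length of the \<open>y\<close>-step.  Mixing contracts \<open>q\<close> and \<open>r\<close> by \<open>1 - \<rho> / 2\<close>, where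
  \<open>\<rho> = 1 - lam\<^sup>2\<close>; strong concavity contracts \<open>\<delta>\<close> by \<open>1 - a\<close>, where \<open>a = \<eta>y * \<mu>\<close>, and yields the
  negative term \<open>- 7 / 9 * s\<close>, so that the sum of the \<open>s t\<close> is bounded without a factor \<open>1 / a\<close>.
  The maximisers must be taken at the mean point and not at the local points: otherwise the
  coefficient of \<open>q\<close> becomes \<open>\<kappa> ^ 4\<close> instead of \<open>\<kappa>\<^sup>2\<close>.  Summing these recursions over time gives
  a linear system whose feedback is small because of the three terms of \<open>\<gamma>\<close>, and the descent
  inequality for \<open>\<Phi>\<close> then absorbs the remaining mean-gradient energy.
\<close>

section \<open>Gradients, projections and maximisers\<close>

lemma subspace_euclid: "subspace (euclid m)"
  by (auto simp: subspace_def euclid_def)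

lemma proj_closest:
  assumes "compact S" "S \<noteq> {}"
  shows "proj S a \<in> S" "\<forall>z\<in>S. dist a (proj S a) \<le> dist a z"
proof -
  have "\<exists>y. y \<in> S \<and> (\<forall>z\<in>S. dist a y \<le> dist a z)"
    using continuous_attains_inf[OF assms continuous_on_dist[OF continuous_on_const continuous_on_id]]
    by blast
  from someI_ex[OF this] show "proj S a \<in> S" "\<forall>z\<in>S. dist a (proj S a) \<le> dist a z"
    unfolding proj_def by auto
qed

lemma proj_inner_le:
  fixes a :: "'a::real_inner"
  assumes "compact S" "convex S" "z \<in> S"
  shows "(a - proj S a) \<bullet> (z - proj S a) \<le> 0"
proof -
  have "S \<noteq> {}" using assms by auto
  then show ?thesis
    using any_closest_point_dot[OF assms(2) compact_imp_closed[OF assms(1)] _ assms(3)]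
      proj_closest[OF assms(1)] by metis
qed

text \<open>Two candidates differ by some \<open>e\<close> in \<open>S\<close>, and the line
  \<open>x + t *\<^sub>R e\<close> stays in \<open>S\<close>. Along it the derivative within
  \<open>S\<close> becomes an ordinary derivative on the reals, whose uniqueness gives
  \<open>e \<bullet> e = 0\<close>.\<close>

lemma gradient_on_eqI:
  assumes S: "subspace S" and x: "x \<in> S" and v: "v \<in> S"
    and der: "(F has_derivative (\<lambda>h. v \<bullet> h)) (at x within S)"
  shows "gradient_on S F x = v"
  unfolding gradient_on_def
proof (rule the_equality)
  show "v \<in> S \<and> (F has_derivative (\<lambda>h. v \<bullet> h)) (at x within S)" using v der by simp
next
  fix w assume w: "w \<in> S \<and> (F has_derivative (\<lambda>h. w \<bullet> h)) (at x within S)"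
  define e where "e = w - v"
  have eS: "e \<in> S" unfolding e_def using S w v by (simp add: subspace_diff)
  have D: "((\<lambda>t::real. F (x + t *\<^sub>R e)) has_derivative (\<lambda>t. u \<bullet> (t *\<^sub>R e))) (at 0)"
    if "(F has_derivative (\<lambda>h. u \<bullet> h)) (at x within S)" for u
  proof (rule has_derivative_in_compose[where f = "\<lambda>t::real. x + t *\<^sub>R e" and g = F and x = 0])
    show "((\<lambda>t::real. x + t *\<^sub>R e) has_derivative (\<lambda>t. t *\<^sub>R e)) (at 0)"
      by (auto intro!: derivative_eq_intros)
    have "range (\<lambda>t::real. x + t *\<^sub>R e) \<subseteq> S"
      using S x eS by (auto intro!: subspace_add subspace_scale)
    then show "(F has_derivative (\<lambda>h. u \<bullet> h)) (at (x + 0 *\<^sub>R e) within range (\<lambda>t::real. x + t *\<^sub>R e))"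
      using has_derivative_subset[OF that] by simp
  qed
  have "(\<lambda>t::real. w \<bullet> (t *\<^sub>R e)) = (\<lambda>t. v \<bullet> (t *\<^sub>R e))"
    using has_derivative_unique[OF D D] w der by blast
  then have "w \<bullet> (1 *\<^sub>R e) = v \<bullet> (1 *\<^sub>R e)" by (rule fun_cong)
  then have "e \<bullet> e = 0" unfolding e_def by (simp add: inner_diff_left)
  then show "w = v" by (simp add: e_def)
qed

text \<open>The error quotient is at most \<open>c * norm (y - x)\<close>, which tends to 0. This
  turns the quadratic estimate for \<Phi> into differentiability, so that envelope formula and
  smoothness come from a single estimate.\<close>

lemma has_derivative_quadratic_error:
  fixes F :: "'a::real_inner \<Rightarrow> real"
  assumes "\<And>y. y \<in> S \<Longrightarrow> \<bar>F y - F x - v \<bullet> (y - x)\<bar> \<le> c * (norm (y - x))\<^sup>2"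
  shows "(F has_derivative (\<lambda>h. v \<bullet> h)) (at x within S)"
proof (rule has_derivativeI_sandwich[where e = 1 and H = "\<lambda>y. c * norm (y - x)"])
  show "bounded_linear ((\<bullet>) v)" by (rule bounded_linear_inner_right)
  show "((\<lambda>y. c * norm (y - x)) \<longlongrightarrow> 0) (at x within S)"
    by (auto intro!: tendsto_eq_intros)
next
  fix y assume "y \<in> S" "y \<noteq> x"
  with assms[of y] show "norm (F y - F x - v \<bullet> (y - x)) / norm (y - x) \<le> c * norm (y - x)"
    by (simp add: divide_simps power2_eq_square mult.assoc)
qed simp

lemma abs_inner_le: "norm a \<le> c \<Longrightarrow> a \<bullet> b \<le> c * norm b" for a b :: "'a::real_inner"
  by (meson norm_cauchy_schwarz mult_right_mono norm_ge_zero order_trans)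

section \<open>One agent: maximisers of a strongly concave function and the projected ascent
  step\<close>

locale agent =
  fixes d m :: nat and Y :: "fvec set" and F :: "fvec \<times> fvec \<Rightarrow> real"
    and G :: "fvec \<times> fvec \<Rightarrow> fvec \<times> fvec" and L \<mu> :: real
  assumes gradF: "is_gradient d m Y F G"
    and smooth: "smooth_grad d Y L G"
    and concave: "strongly_concave_y d Y \<mu> F G"
    and L_pos: "L > 0" and mu_pos: "\<mu> > 0"
    and Y_sub: "Y \<subseteq> euclid m" and Y_ne: "Y \<noteq> {}" and Y_conv: "convex Y" and Y_comp: "compact Y"
begin

abbreviation gx where "gx x y \<equiv> fst (G (x, y))"
abbreviation gy where "gy x y \<equiv> snd (G (x, y))"

lemma gx_in: "x \<in> euclid d \<Longrightarrow> y \<in> Y \<Longrightarrow> gx x y \<in> euclid d"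
  using gradF unfolding is_gradient_def by (metis SigmaI mem_Times_iff)

lemma gx_lip:
  assumes "x \<in> euclid d" "x' \<in> euclid d" "y \<in> Y" "y' \<in> Y"
  shows "norm (gx x y - gx x' y') \<le> L * (norm (x - x') + norm (y - y'))"
proof -
  have "norm (gx x y - gx x' y') \<le> norm (G (x, y) - G (x', y'))"
    by (metis norm_fst_le fst_diff prod.collapse)
  also have "\<dots> \<le> L * (norm (x - x') + norm (y - y'))"
    using smooth assms unfolding smooth_grad_def by blast
  finally show ?thesis .
qed

lemma gy_lip:
  assumes "x \<in> euclid d" "x' \<in> euclid d" "y \<in> Y" "y' \<in> Y"
  shows "norm (gy x y - gy x' y') \<le> L * (norm (x - x') + norm (y - y'))"
proof -
  have "norm (gy x y - gy x' y') \<le> norm (G (x, y) - G (x', y'))"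
    by (metis norm_snd_le snd_diff prod.collapse)
  also have "\<dots> \<le> L * (norm (x - x') + norm (y - y'))"
    using smooth assms unfolding smooth_grad_def by blast
  finally show ?thesis .
qed

lemma concave_at:
  assumes "x \<in> euclid d" "y \<in> Y" "y' \<in> Y"
  shows "F (x, y) \<le> F (x, y') + gy x y' \<bullet> (y - y') - \<mu> / 2 * (norm (y - y'))\<^sup>2"
  using concave assms unfolding strongly_concave_y_def by blast

definition ystar where "ystar x = (SOME y. y \<in> Y \<and> (\<forall>z\<in>Y. F (x, z) \<le> F (x, y)))"

lemma
  assumes x: "x \<in> euclid d"
  shows ystar_in: "ystar x \<in> Y" and ystar_max: "\<And>z. z \<in> Y \<Longrightarrow> F (x, z) \<le> F (x, ystar x)"
proof -
  have "continuous_on (euclid d \<times> Y) F"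
    using gradF unfolding is_gradient_def
    by (auto simp: continuous_on_eq_continuous_within intro: has_derivative_continuous)
  then have "continuous_on Y (\<lambda>y. F (x, y))"
    by (rule continuous_on_compose2) (use x in \<open>auto intro!: continuous_intros\<close>)
  from continuous_attains_sup[OF Y_comp Y_ne this]
  have "\<exists>y. y \<in> Y \<and> (\<forall>z\<in>Y. F (x, z) \<le> F (x, y))" by blast
  from someI_ex[OF this] show "ystar x \<in> Y" "\<And>z. z \<in> Y \<Longrightarrow> F (x, z) \<le> F (x, ystar x)"
    unfolding ystar_def by auto
qed

lemma SUP_eq_ystar:
  assumes "x \<in> euclid d" shows "(SUP y\<in>Y. F (x, y)) = F (x, ystar x)"
  by (rule cSup_eq_maximum) (use ystar_in ystar_max assms in auto)

text \<open>Concavity at a point between the maximiser and \<open>y\<close> gives the inequality there; the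
  gradient being Lipschitz, the point may be moved to the maximiser.\<close>

lemma ystar_opt:
  assumes x: "x \<in> euclid d" and y: "y \<in> Y"
  shows "gy x (ystar x) \<bullet> (y - ystar x) \<le> 0"
proof (rule ccontr)
  let ?s = "ystar x"
  define c where "c = gy x ?s \<bullet> (y - ?s)"
  define N where "N = L * (norm (y - ?s))\<^sup>2"
  assume "\<not> ?thesis"
  then have c: "c > 0" by (simp add: c_def)
  have sY: "?s \<in> Y" using x by (rule ystar_in)
  have key: "c \<le> \<theta> * N" if \<theta>: "0 < \<theta>" "\<theta> \<le> 1" for \<theta>
  proof -
    define z where "z = ?s + \<theta> *\<^sub>R (y - ?s)"
    have "z = (1 - \<theta>) *\<^sub>R ?s + \<theta> *\<^sub>R y" by (simp add: z_def algebra_simps)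
    then have z: "z \<in> Y" using Y_conv sY y \<theta> by (simp add: convexD)
    have "F (x, ?s) \<le> F (x, z) + gy x z \<bullet> (?s - z) - \<mu> / 2 * (norm (?s - z))\<^sup>2"
      using concave_at x sY z by blast
    moreover have "F (x, z) \<le> F (x, ?s)" using x z by (rule ystar_max)
    moreover have "0 \<le> \<mu> / 2 * (norm (?s - z))\<^sup>2" using mu_pos by simp
    ultimately have "0 \<le> gy x z \<bullet> (?s - z)" by linarith
    moreover have "gy x z \<bullet> (?s - z) = - \<theta> * (gy x z \<bullet> (y - ?s))"
      by (simp add: z_def)
    ultimately have "gy x z \<bullet> (y - ?s) \<le> 0"
      using \<theta> by (simp add: mult_le_0_iff zero_le_mult_iff)
    moreover have "(gy x ?s - gy x z) \<bullet> (y - ?s) \<le> L * (norm (x - x) + norm (?s - z)) * norm (y - ?s)"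
      by (intro abs_inner_le gy_lip x sY z)
    moreover have "norm (?s - z) = \<theta> * norm (y - ?s)" using \<theta> by (simp add: z_def)
    ultimately show ?thesis
      by (simp add: c_def N_def inner_diff_left power2_eq_square algebra_simps)
  qed
  have "N > 0" using key[of 1] c by simp
  \<comment> \<open>Any admissible \<theta> with \<open>\<theta> * N \<le> c / 2\<close> contradicts
    \<open>key\<close>; the minimum with 1 keeps the point on the segment.\<close>
  define \<theta> where "\<theta> = min 1 (c / (2 * N))"
  have "c \<le> \<theta> * N" using c \<open>N > 0\<close> by (intro key) (auto simp: \<theta>_def)
  also have "\<dots> \<le> c / (2 * N) * N" using \<open>N > 0\<close> by (intro mult_right_mono) (auto simp: \<theta>_def)
  also have "\<dots> = c / 2" using \<open>N > 0\<close> by simp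
  finally show False using c by simp
qed

text \<open>Concavity is used at the maximiser, where the linear term is nonpositive by
  \<open>ystar_opt\<close>.\<close>

lemma ystar_quadratic_growth:
  assumes "x \<in> euclid d" "y \<in> Y"
  shows "F (x, y) + \<mu> / 2 * (norm (y - ystar x))\<^sup>2 \<le> F (x, ystar x)"
  using concave_at[OF assms ystar_in] ystar_opt[OF assms] assms by fastforce

text \<open>Adding the concavity inequalities between the two maximisers at \<open>x\<close>, and
  dropping the terms that optimality makes nonpositive, leaves the difference of the
  \<open>y\<close>-gradients at \<open>x\<close> and \<open>x'\<close> for the same
  \<open>y'\<close>. Only the Lipschitz bound in \<open>x\<close> is then called for.\<close>

lemma ystar_lip:
  assumes x: "x \<in> euclid d" "x' \<in> euclid d"
  shows "norm (ystar x - ystar x') \<le> L / \<mu> * norm (x - x')"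
proof -
  define y y' where "y = ystar x" and "y' = ystar x'"
  have Y: "y \<in> Y" "y' \<in> Y" using x ystar_in by (auto simp: y_def y'_def)
  have 1: "gy x y \<bullet> (y' - y) \<le> 0" and 2: "gy x' y' \<bullet> (y - y') \<le> 0"
    using ystar_opt x Y by (auto simp: y_def y'_def)
  have "F (x, y) \<le> F (x, y') + gy x y' \<bullet> (y - y') - \<mu> / 2 * (norm (y - y'))\<^sup>2"
    "F (x, y') \<le> F (x, y) + gy x y \<bullet> (y' - y) - \<mu> / 2 * (norm (y' - y))\<^sup>2"
    using concave_at x Y by blast+
  moreover have "(gy x y' - gy x' y') \<bullet> (y - y') \<le> L * (norm (x - x') + norm (y' - y')) * norm (y - y')"
    by (intro abs_inner_le gy_lip x Y)
  ultimately have "\<mu> * (norm (y - y'))\<^sup>2 \<le> L * norm (x - x') * norm (y - y')"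
    using 1 2 by (simp add: norm_minus_commute inner_diff_left)
  then have "\<mu> * norm (y - y') \<le> L * norm (x - x')"
  proof (cases "norm (y - y') = 0")
    case True
    then show ?thesis using L_pos by simp
  next
    case False
    then have "0 < norm (y - y')" by simp
    moreover assume "\<mu> * (norm (y - y'))\<^sup>2 \<le> L * norm (x - x') * norm (y - y')"
    then have "(\<mu> * norm (y - y')) * norm (y - y') \<le> (L * norm (x - x')) * norm (y - y')"
      by (simp add: power2_eq_square mult.assoc)
    ultimately show ?thesis by (simp add: mult_le_cancel_right)
  qed
  then show ?thesis using mu_pos by (simp add: y_def y'_def field_simps)
qed

text \<open>Strong concavity makes \<open>- gy\<close> strongly monotone with modulus \<mu>, while
  smoothness bounds the same inner product by \<open>L\<close>. Two distinct points of
  \<open>Y\<close> turn this into \<mu> \<le> \<open>L\<close>; a positive diameter will supply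
  them.\<close>

lemma mu_le_L:
  assumes Y: "y \<in> Y" "y' \<in> Y" "y \<noteq> y'"
  shows "\<mu> \<le> L"
proof -
  have x: "0 \<in> euclid d" by (simp add: euclid_def)
  have "F (0, y) \<le> F (0, y') + gy 0 y' \<bullet> (y - y') - \<mu> / 2 * (norm (y - y'))\<^sup>2"
    "F (0, y') \<le> F (0, y) + gy 0 y \<bullet> (y' - y) - \<mu> / 2 * (norm (y' - y))\<^sup>2"
    using concave_at x Y by blast+
  moreover have "(gy 0 y' - gy 0 y) \<bullet> (y - y') \<le> L * (norm (0 - 0 :: fvec) + norm (y' - y)) * norm (y - y')"
    by (intro abs_inner_le gy_lip x Y)
  ultimately have "\<mu> * (norm (y - y'))\<^sup>2 \<le> L * (norm (y - y'))\<^sup>2"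
    by (simp add: norm_minus_commute inner_diff power2_eq_square)
  then show ?thesis using Y by simp
qed

text \<open>The mean value theorem is applied on the segment from \<open>x\<close> to
  \<open>x'\<close> with \<open>y\<close> fixed, which stays in the set where \<open>F\<close> is
  differentiable. It gives the constant \<open>L\<close> rather than \<open>L / 2\<close>, which is
  good enough here.\<close>

lemma linearization_error:
  assumes x: "x \<in> euclid d" "x' \<in> euclid d" and y: "y \<in> Y"
  shows "\<bar>F (x', y) - F (x, y) - gx x y \<bullet> (x' - x)\<bar> \<le> L * (norm (x' - x))\<^sup>2"
proof -
  define p where "p t = x + t *\<^sub>R (x' - x)" for t
  have p: "p t \<in> euclid d" for t
    unfolding p_def using x subspace_euclid by (simp add: subspace_add subspace_diff subspace_scale)
  have "((\<lambda>t. F (p t, y)) has_derivative (\<lambda>s. G (p t, y) \<bullet> (s *\<^sub>R (x' - x), 0))) (at t within {0..1})"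
    if "t \<in> {0..1}" for t
  proof (rule has_derivative_in_compose2[where g = F and f = "\<lambda>t. (p t, y)" and t = "euclid d \<times> Y"
        and g' = "\<lambda>z h. G z \<bullet> h"])
    show "(F has_derivative (\<lambda>h. G z \<bullet> h)) (at z within euclid d \<times> Y)" if "z \<in> euclid d \<times> Y" for z
      using gradF that unfolding is_gradient_def by blast
    show "((\<lambda>t. (p t, y)) has_derivative (\<lambda>s. (s *\<^sub>R (x' - x), 0))) (at t within {0..1})"
      unfolding p_def by (auto intro!: derivative_eq_intros)
  qed (use p y that in auto)
  then obtain t where t: "t \<in> {0..1}"
    and "F (p 1, y) - F (p 0, y) = G (p t, y) \<bullet> ((1 - 0) *\<^sub>R (x' - x), 0)"
    using mvt_very_simple[of 0 1 "\<lambda>t. F (p t, y)" "\<lambda>t s. G (p t, y) \<bullet> (s *\<^sub>R (x' - x), 0)"] by force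
  then have "F (x', y) - F (x, y) - gx x y \<bullet> (x' - x) = (gx (p t) y - gx x y) \<bullet> (x' - x)"
    by (simp add: p_def inner_diff_left inner_prod_def)
  also have "\<bar>\<dots>\<bar> \<le> norm (gx (p t) y - gx x y) * norm (x' - x)" by (rule Cauchy_Schwarz_ineq2)
  also have "\<dots> \<le> L * (norm (p t - x) + norm (y - y)) * norm (x' - x)"
    by (intro mult_right_mono gx_lip p x y) simp
  also have "\<dots> = L * t * (norm (x' - x))\<^sup>2" using t by (simp add: p_def power2_eq_square)
  also have "\<dots> \<le> L * 1 * (norm (x' - x))\<^sup>2"
    using t L_pos by (intro mult_right_mono mult_left_mono) auto
  finally show ?thesis by simp
qed

text \<open>Comparing the maximum at one point with the value of the other maximiser there.\<close>

lemma danskin: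
  assumes x: "x \<in> euclid d" "x' \<in> euclid d"
  shows "\<bar>(SUP y\<in>Y. F (x', y)) - (SUP y\<in>Y. F (x, y)) - gx x (ystar x) \<bullet> (x' - x)\<bar>
    \<le> L * (1 + L / \<mu>) * (norm (x' - x))\<^sup>2"
proof -
  define y y' where "y = ystar x" and "y' = ystar x'"
  have Y: "y \<in> Y" "y' \<in> Y" using x ystar_in by (auto simp: y_def y'_def)
  \<comment> \<open>The first inequality bounds the increment of the maximum from below by the
    increment at \<open>y\<close>, the second from above by the increment at \<open>y'\<close>.
    Replacing \<open>gx x y'\<close> by \<open>gx x y\<close> in the upper bound costs the extra
    \<open>L * (L / \<mu>)\<close>.\<close>
  have "F (x', y) \<le> F (x', y')" "F (x, y') \<le> F (x, y)"
    using x Y ystar_max by (auto simp: y_def y'_def)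
  moreover have "\<bar>F (x', y) - F (x, y) - gx x y \<bullet> (x' - x)\<bar> \<le> L * (norm (x' - x))\<^sup>2"
    "\<bar>F (x', y') - F (x, y') - gx x y' \<bullet> (x' - x)\<bar> \<le> L * (norm (x' - x))\<^sup>2"
    using x Y linearization_error by blast+
  moreover have "(gx x y' - gx x y) \<bullet> (x' - x) \<le> L * (L / \<mu>) * (norm (x' - x))\<^sup>2"
  proof -
    have "(gx x y' - gx x y) \<bullet> (x' - x) \<le> L * (norm (x - x) + norm (y' - y)) * norm (x' - x)"
      by (intro abs_inner_le gx_lip x Y)
    also have "\<dots> \<le> L * (L / \<mu> * norm (x' - x)) * norm (x' - x)"
      using ystar_lip[OF x(2,1)] L_pos by (intro mult_right_mono mult_left_mono) (auto simp: y_def y'_def)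
    finally show ?thesis by (simp add: power2_eq_square mult.assoc)
  qed
  moreover have "0 \<le> L * (L / \<mu>) * (norm (x' - x))\<^sup>2" using L_pos mu_pos by simp
  ultimately show ?thesis
    using x by (simp add: SUP_eq_ystar y_def y'_def inner_diff_left distrib_left distrib_right abs_le_iff)
qed

text \<open>The step uses the gradient at \<open>x'\<close> but is compared with the maximiser at \<open>x\<close>.\<close>

lemma ascent_step:
  assumes x: "x \<in> euclid d" "x' \<in> euclid d" and y: "y \<in> Y" and eta: "\<eta> > 0"
  defines "y' \<equiv> proj Y (y + \<eta> *\<^sub>R gy x' y)"
  shows "(1 + \<eta> * \<mu> / 2) * (norm (y' - ystar x))\<^sup>2 + (1 - 2 * \<eta> * L) * (norm (y' - y))\<^sup>2
    \<le> (1 - \<eta> * \<mu>) * (norm (y - ystar x))\<^sup>2 + 2 * \<eta> * L\<^sup>2 / \<mu> * (norm (x' - x))\<^sup>2"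
proof -
  define s where "s = ystar x"
  have s: "s \<in> Y" using x ystar_in by (simp add: s_def)
  have y': "y' \<in> Y" unfolding y'_def by (rule proj_closest(1)[OF Y_comp Y_ne])
  have "(y + \<eta> *\<^sub>R gy x' y - y') \<bullet> (s - y') \<le> 0"
    unfolding y'_def by (rule proj_inner_le[OF Y_comp Y_conv s])
  then have pr: "2 * \<eta> * (gy x' y \<bullet> (s - y')) \<le> (norm (y - s))\<^sup>2 - (norm (y' - s))\<^sup>2 - (norm (y' - y))\<^sup>2"
    by (simp add: power2_norm_eq_inner inner_diff inner_add inner_commute)
  have "(gy x' y - gy x y) \<bullet> (y' - s) \<le> L * (norm (x' - x) + norm (y - y)) * norm (y' - s)"
    by (intro abs_inner_le gy_lip x y)
  then have "2 * \<eta> * ((gy x' y - gy x y) \<bullet> (y' - s)) \<le> 2 * \<eta> * (L * norm (x' - x) * norm (y' - s))"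
    using eta by simp
  also have "\<dots> \<le> \<eta> * \<mu> / 2 * (norm (y' - s))\<^sup>2 + 2 * \<eta> * L\<^sup>2 / \<mu> * (norm (x' - x))\<^sup>2"
  proof -
    \<comment> \<open>Young's inequality, weighted so as to consume only half of the gain
      \<open>\<eta> * \<mu>\<close> in front of \<open>(norm (y' - s))\<^sup>2\<close>.\<close>
    have "0 \<le> \<eta> / (2 * \<mu>) * (\<mu> * norm (y' - s) - 2 * L * norm (x' - x))\<^sup>2"
      using eta mu_pos by simp
    then show ?thesis using mu_pos by (simp add: power2_eq_square field_simps)
  qed
  finally have err: "2 * \<eta> * ((gy x' y - gy x y) \<bullet> (y' - s))
      \<le> \<eta> * \<mu> / 2 * (norm (y' - s))\<^sup>2 + 2 * \<eta> * L\<^sup>2 / \<mu> * (norm (x' - x))\<^sup>2" .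
  \<comment> \<open>Concavity at \<open>y'\<close> together with the Lipschitz gradient serves as
    the ascent inequality from \<open>y\<close> to \<open>y'\<close>. Modulus \<mu> / 2 is gained
    twice: for \<open>y\<close> by concavity at \<open>y\<close>, for \<open>y'\<close> by quadratic
    growth at the maximiser.\<close>
  have "F (x, y) \<le> F (x, y') + gy x y' \<bullet> (y - y') - \<mu> / 2 * (norm (y - y'))\<^sup>2"
    "F (x, s) \<le> F (x, y) + gy x y \<bullet> (s - y) - \<mu> / 2 * (norm (s - y))\<^sup>2"
    using concave_at x y y' s by blast+
  moreover have "F (x, y') + \<mu> / 2 * (norm (y' - s))\<^sup>2 \<le> F (x, s)"
    using ystar_quadratic_growth x y' by (simp add: s_def)
  moreover have "(gy x y' - gy x y) \<bullet> (y - y') \<le> L * (norm (x - x) + norm (y' - y)) * norm (y - y')"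
    by (intro abs_inner_le gy_lip x y y')
  moreover have "0 \<le> \<mu> / 2 * (norm (y - y'))\<^sup>2" using mu_pos by simp
  ultimately have "\<mu> / 2 * (norm (y' - s))\<^sup>2 + \<mu> / 2 * (norm (y - s))\<^sup>2
      \<le> gy x y \<bullet> (s - y') + L * (norm (y' - y))\<^sup>2"
    by (simp add: inner_diff norm_minus_commute power2_eq_square)
  then have "2 * \<eta> * (\<mu> / 2 * (norm (y' - s))\<^sup>2 + \<mu> / 2 * (norm (y - s))\<^sup>2)
      \<le> 2 * \<eta> * (gy x y \<bullet> (s - y') + L * (norm (y' - y))\<^sup>2)"
    using eta by simp
  with pr err show ?thesis
    unfolding s_def[symmetric] by (simp add: inner_diff algebra_simps)
qed

end

section \<open>Averaging and mixing\<close>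

lemma coord_sum: "coord (\<Sum>i\<in>I. f i) k = (\<Sum>i\<in>I. coord (f i) k)"
  by (induction I rule: infinite_finite_induct) auto

lemma power2_norm_fvec:
  assumes "finite K" "{k. coord v k \<noteq> 0} \<subseteq> K"
  shows "(norm v)\<^sup>2 = (\<Sum>k\<in>K. (coord v k)\<^sup>2)"
  using inner_fvec_eq[OF assms, of v] by (simp only: power2_norm_eq_inner) (simp only: power2_eq_square)

lemma coord_Fvec_below: "coord (Fvec (\<lambda>i. if i < n then f i else 0)) k = (if k < n then f k else 0)"
proof -
  have "finite {k. (if k < n then f k else 0) \<noteq> 0}"
    by (rule finite_subset[of _ "{..<n}"]) auto
  then show ?thesis by (simp add: coord_Fvec)
qed

lemma power2_norm_Fvec_below: "(norm (Fvec (\<lambda>i. if i < n then f i else 0)))\<^sup>2 = (\<Sum>i<n. (f i)\<^sup>2)"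
  by (subst power2_norm_fvec[where K = "{..<n}"]) (auto simp: coord_Fvec_below)

lemma bounded_linear_coord: "bounded_linear (\<lambda>v. coord v k)"
proof (rule bounded_linear_intro[where K = 1])
  fix v
  have "(coord v k)\<^sup>2 \<le> (\<Sum>l\<in>insert k {l. coord v l \<noteq> 0}. (coord v l)\<^sup>2)"
    by (rule member_le_sum) (auto simp: finite_coord)
  also have "\<dots> = (norm v)\<^sup>2"
    by (rule power2_norm_fvec[symmetric]) (auto simp: finite_coord)
  finally show "norm (coord v k) \<le> norm v * 1"
    by (simp add: abs_le_square_iff[symmetric])
qed simp_all

text \<open>The space \<open>fvec\<close> is infinite-dimensional, so linearity alone does not give
  boundedness. Writing the map as a finite sum of bounded rank-one maps makes \<open>onorm\<close> a
  genuine bound.\<close>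

lemma bounded_linear_mat_apply: "bounded_linear (mat_apply n A)"
proof -
  \<comment> \<open>The unit vector with index \<open>i\<close>; the cut at \<open>Suc i\<close>
    only brings it into the form handled by \<open>coord_Fvec_below\<close>.\<close>
  define e where "e i = Fvec (\<lambda>k. if k < Suc i then of_bool (k = i) else 0)" for i
  have e: "coord (e i) k = (if k = i then 1 else 0)" for i k
    by (simp add: e_def coord_Fvec_below)
  have "mat_apply n A = (\<lambda>v. \<Sum>i<n. (\<Sum>j<n. A i j * coord v j) *\<^sub>R e i)"
    by (intro ext fvec_eqI) (simp add: mat_apply_def coord_Fvec_below coord_sum e if_distrib cong: if_cong)
  moreover have "bounded_linear \<dots>"
    by (intro bounded_linear_sum bounded_linear_scaleR_const[OF bounded_linear_sum]
        bounded_linear_const_mult bounded_linear_coord)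
  ultimately show ?thesis by simp
qed

lemma spectral_norm_nonneg: "0 \<le> spectral_norm n A"
  unfolding spectral_norm_def by (rule onorm_pos_le[OF bounded_linear_mat_apply])

text \<open>Apply the scalar bound to each column of the matrix with rows \<open>X j\<close>.\<close>

lemma spectral_norm_rows:
  fixes X :: "nat \<Rightarrow> fvec"
  shows "(\<Sum>i<n. (norm (\<Sum>j<n. A i j *\<^sub>R X j))\<^sup>2) \<le> (spectral_norm n A)\<^sup>2 * (\<Sum>j<n. (norm (X j))\<^sup>2)"
proof -
  \<comment> \<open>A common finite support of all rows: every norm becomes a sum over
    \<open>K\<close>, and rows and columns can be exchanged.\<close>
  define K where "K = (\<Union>j<n. {k. coord (X j) k \<noteq> 0})"
  have K: "finite K" unfolding K_def by (auto simp: finite_coord)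
  define c where "c k = Fvec (\<lambda>j. if j < n then coord (X j) k else 0)" for k
  have "(\<Sum>i<n. (norm (\<Sum>j<n. A i j *\<^sub>R X j))\<^sup>2) = (\<Sum>i<n. \<Sum>k\<in>K. (\<Sum>j<n. A i j * coord (X j) k)\<^sup>2)"
  proof (rule sum.cong[OF refl])
    fix i
    have "{k. coord (\<Sum>j<n. A i j *\<^sub>R X j) k \<noteq> 0} \<subseteq> K"
      unfolding K_def coord_sum coord_scaleR by (force elim: sum.not_neutral_contains_not_neutral)
    from power2_norm_fvec[OF K this]
    show "(norm (\<Sum>j<n. A i j *\<^sub>R X j))\<^sup>2 = (\<Sum>k\<in>K. (\<Sum>j<n. A i j * coord (X j) k)\<^sup>2)"
      by (simp add: coord_sum)
  qed
  also have "\<dots> = (\<Sum>k\<in>K. \<Sum>i<n. (\<Sum>j<n. A i j * coord (X j) k)\<^sup>2)" by (rule sum.swap)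
  also have "\<dots> = (\<Sum>k\<in>K. (norm (mat_apply n A (c k)))\<^sup>2)"
    by (simp add: mat_apply_def power2_norm_Fvec_below c_def coord_Fvec_below)
  also have "\<dots> \<le> (\<Sum>k\<in>K. (spectral_norm n A * norm (c k))\<^sup>2)"
    unfolding spectral_norm_def
    by (intro sum_mono power_mono onorm bounded_linear_mat_apply) simp
  also have "\<dots> = (spectral_norm n A)\<^sup>2 * (\<Sum>k\<in>K. \<Sum>j<n. (coord (X j) k)\<^sup>2)"
    by (simp add: power_mult_distrib sum_distrib_left c_def power2_norm_Fvec_below)
  also have "(\<Sum>k\<in>K. \<Sum>j<n. (coord (X j) k)\<^sup>2) = (\<Sum>j<n. \<Sum>k\<in>K. (coord (X j) k)\<^sup>2)" by (rule sum.swap)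
  also have "\<dots> = (\<Sum>j<n. (norm (X j))\<^sup>2)"
    by (intro sum.cong refl power2_norm_fvec[symmetric] K) (auto simp: K_def)
  finally show ?thesis .
qed

section \<open>Squared distance of a family to its mean\<close>

definition deviation :: "nat \<Rightarrow> (nat \<Rightarrow> 'a::real_inner) \<Rightarrow> real" where
  "deviation n X = (\<Sum>i<n. (norm (X i - avg n X))\<^sup>2)"

lemma deviation_nonneg: "0 \<le> deviation n X"
  by (simp add: deviation_def sum_nonneg)

lemma avg_add: "avg n (\<lambda>i. X i + Z i) = avg n X + avg n Z"
  by (simp add: avg_def sum.distrib scaleR_add_right)

lemma avg_diff: "avg n (\<lambda>i. X i - Z i) = avg n X - avg n Z"
  by (simp add: avg_def sum_subtractf scaleR_diff_right)

lemma avg_scaleR: "avg n (\<lambda>i. c *\<^sub>R X i) = c *\<^sub>R avg n X"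
  by (simp add: avg_def scaleR_sum_right mult.commute)

lemma sum_eq_avg: "n \<ge> 1 \<Longrightarrow> (\<Sum>i<n. X i) = real n *\<^sub>R avg n X"
  by (simp add: avg_def)

text \<open>Pythagoras: the deviations sum to zero and are therefore orthogonal to the constant
  family formed by the mean.\<close>

lemma sum_power2_norm_eq:
  fixes X :: "nat \<Rightarrow> 'a::real_inner"
  assumes "n \<ge> 1"
  shows "(\<Sum>i<n. (norm (X i))\<^sup>2) = deviation n X + real n * (norm (avg n X))\<^sup>2"
proof -
  have "(\<Sum>i<n. 2 * (X i \<bullet> avg n X)) = real n * (2 * (avg n X \<bullet> avg n X))"
    using assms by (simp add: inner_sum_left[symmetric] sum_distrib_left[symmetric] sum_eq_avg)
  then show ?thesis
    by (simp add: deviation_def power2_norm_eq_inner inner_diff inner_commute sum.distrib sum_subtractf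
        algebra_simps)
qed

lemma deviation_scaleR: "deviation n (\<lambda>i. c *\<^sub>R X i) = c\<^sup>2 * deviation n X"
  by (simp add: deviation_def avg_scaleR scaleR_diff_right[symmetric] power_mult_distrib sum_distrib_left)

lemma power2_norm_add_le:
  fixes u v :: "'a::real_inner"
  assumes "c > 0"
  shows "(norm (u + v))\<^sup>2 \<le> (1 + c) * (norm u)\<^sup>2 + (1 + 1 / c) * (norm v)\<^sup>2"
proof -
  have "0 \<le> (1 / c) * (norm (c *\<^sub>R u - v))\<^sup>2" using assms by simp
  also have "\<dots> = c * (u \<bullet> u) + (1 / c) * (v \<bullet> v) - 2 * (u \<bullet> v)"
    using assms by (simp add: power2_norm_eq_inner inner_diff inner_commute field_simps)
  finally show ?thesis
    by (simp add: power2_norm_eq_inner inner_add inner_commute algebra_simps)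
qed

lemma deviation_add_le:
  assumes "c > 0"
  shows "deviation n (\<lambda>i. X i + Z i) \<le> (1 + c) * deviation n X + (1 + 1 / c) * deviation n Z"
  unfolding deviation_def sum_distrib_left sum.distrib[symmetric]
proof (rule sum_mono)
  fix i
  have "X i + Z i - avg n (\<lambda>i. X i + Z i) = (X i - avg n X) + (Z i - avg n Z)"
    by (simp add: avg_add)
  then show "(norm (X i + Z i - avg n (\<lambda>i. X i + Z i)))\<^sup>2
      \<le> (1 + c) * (norm (X i - avg n X))\<^sup>2 + (1 + 1 / c) * (norm (Z i - avg n Z))\<^sup>2"
    using power2_norm_add_le[OF assms] by metis
qed

lemma deviation_le: "n \<ge> 1 \<Longrightarrow> deviation n X \<le> (\<Sum>i<n. (norm (X i))\<^sup>2)"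
  using sum_power2_norm_eq[of n X] by simp

lemma norm_avg_le: "n \<ge> 1 \<Longrightarrow> real n * (norm (avg n X))\<^sup>2 \<le> (\<Sum>i<n. (norm (X i :: 'a::real_inner))\<^sup>2)"
  using sum_power2_norm_eq[of n X] deviation_nonneg[of n X] by simp

section \<open>Mixing over the network and its contraction\<close>

definition mix :: "(nat \<times> nat) set \<Rightarrow> (nat \<Rightarrow> nat \<Rightarrow> real) \<Rightarrow> (nat \<Rightarrow> 'a::real_vector) \<Rightarrow> nat \<Rightarrow> 'a" where
  "mix E W X i = (\<Sum>j\<in>E `` {i}. W i j *\<^sub>R X j)"

locale network =
  fixes n :: nat and E :: "(nat \<times> nat) set" and W :: "nat \<Rightarrow> nat \<Rightarrow> real"
  assumes n: "n \<ge> 1" and graph: "connected_graph n E" and matrix: "mixing_matrix n E W"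
begin

abbreviation lam where "lam \<equiv> spectral_norm n (\<lambda>i j. W i j - 1 / real n)"

lemma neighbours: "E `` {i} \<subseteq> {..<n}"
  using graph by (auto simp: connected_graph_def)

text \<open>Non-neighbours have weight 0. The self-loops of the graph ensure that the diagonal
  weight, which may be positive, is among the neighbours.\<close>

lemma mix_eq:
  assumes "i < n" shows "mix E W X i = (\<Sum>j<n. W i j *\<^sub>R X j)"
  unfolding mix_def
proof (rule sum.mono_neutral_left[OF _ neighbours])
  show "\<forall>j\<in>{..<n} - E `` {i}. W i j *\<^sub>R X j = 0"
    using matrix graph assms unfolding mixing_matrix_def connected_graph_def
    by (metis DiffE ImageI insertI1 lessThan_iff scaleR_zero_left)
qed simp

lemma row_sum: "i < n \<Longrightarrow> (\<Sum>j<n. W i j) = 1"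
  using matrix unfolding mixing_matrix_def by blast

text \<open>By symmetry the columns of \<open>W\<close> sum to 1 as the rows do.\<close>

lemma avg_mix: "avg n (mix E W X) = avg n X"
proof -
  have "(\<Sum>i<n. mix E W X i) = (\<Sum>j<n. \<Sum>i<n. W i j *\<^sub>R X j)"
    by (subst sum.swap) (simp add: mix_eq)
  also have "\<dots> = (\<Sum>j<n. (\<Sum>i<n. W j i) *\<^sub>R X j)"
    unfolding scaleR_sum_left using matrix by (intro sum.cong refl) (metis mixing_matrix_def lessThan_iff)
  also have "\<dots> = (\<Sum>j<n. X j)"
    by (intro sum.cong) (simp_all add: row_sum)
  finally show ?thesis by (simp add: avg_def)
qed

text \<open>Subtracting the constant matrix \<open>1 / n\<close> does not change the action on
  deviations, which sum to zero; hence the spectral norm of the difference controls mixing.\<close>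

lemma deviation_mix: "deviation n (mix E W X) \<le> lam\<^sup>2 * deviation n X"
  for X :: "nat \<Rightarrow> fvec"
proof -
  have "mix E W X i - avg n X = (\<Sum>j<n. (W i j - 1 / real n) *\<^sub>R (X j - avg n X))" if "i < n" for i
  proof -
    have "(\<Sum>j<n. (W i j - 1 / real n) *\<^sub>R (X j - avg n X))
        = (\<Sum>j<n. W i j *\<^sub>R X j) - (\<Sum>j<n. W i j) *\<^sub>R avg n X - (1 / real n) *\<^sub>R (\<Sum>j<n. X j - avg n X)"
      by (simp add: algebra_simps sum.distrib sum_subtractf scaleR_sum_left scaleR_sum_right)
    also have "(\<Sum>j<n. X j - avg n X) = 0"
      using n by (simp add: sum_subtractf sum_eq_avg sum_constant_scaleR)
    finally show ?thesis by (simp add: row_sum mix_eq that)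
  qed
  then have "deviation n (mix E W X) = (\<Sum>i<n. (norm (\<Sum>j<n. (W i j - 1 / real n) *\<^sub>R (X j - avg n X)))\<^sup>2)"
    unfolding deviation_def avg_mix by simp
  then show ?thesis
    unfolding deviation_def by (simp only: spectral_norm_rows)
qed

text \<open>Young's inequality with weight \<rho> / 2 spends half of the contraction
  \<open>lam\<^sup>2 = 1 - \<rho>\<close> on the perturbation, which then enters with the factor 2 /
  \<rho>.\<close>

lemma deviation_mix_add_le:
  fixes X Z :: "nat \<Rightarrow> fvec"
  assumes lam: "lam < 1" and rho: "\<rho> = 1 - lam\<^sup>2"
  shows "deviation n (mix E W (\<lambda>i. X i + Z i)) \<le> (1 - \<rho> / 2) * deviation n X + 2 / \<rho> * deviation n Z"
proof -
  have l0: "0 \<le> lam" by (rule spectral_norm_nonneg)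
  then have "lam\<^sup>2 < 1" using lam by (simp add: power_less_one_iff)
  then have r: "0 < \<rho>" "\<rho> \<le> 1" and l: "lam\<^sup>2 = 1 - \<rho>" by (auto simp: rho)
  have "deviation n (mix E W (\<lambda>i. X i + Z i)) \<le> lam\<^sup>2 * deviation n (\<lambda>i. X i + Z i)"
    by (rule deviation_mix)
  also have "\<dots> \<le> (1 - \<rho>) * ((1 + \<rho> / 2) * deviation n X + (1 + 1 / (\<rho> / 2)) * deviation n Z)"
    unfolding l using r by (intro mult_left_mono deviation_add_le) auto
  also have "\<dots> = ((1 - \<rho>) * (1 + \<rho> / 2)) * deviation n X + ((1 - \<rho>) * (1 + 1 / (\<rho> / 2))) * deviation n Z"
    by (simp only: distrib_left[of "1 - \<rho>" "_ * _" "_ * _"] mult.assoc)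
  also have "\<dots> \<le> (1 - \<rho> / 2) * deviation n X + 2 / \<rho> * deviation n Z"
  proof (intro add_mono mult_right_mono deviation_nonneg)
    have "(1 - \<rho>) * (1 + \<rho> / 2) = (1 - \<rho> / 2) - \<rho>\<^sup>2 / 2" by (simp add: field_simps power2_eq_square)
    then show "(1 - \<rho>) * (1 + \<rho> / 2) \<le> 1 - \<rho> / 2" by simp
    have "(1 - \<rho>) * (1 + 1 / (\<rho> / 2)) = 2 / \<rho> - 1 - \<rho>" using r by (simp add: field_simps)
    then show "(1 - \<rho>) * (1 + 1 / (\<rho> / 2)) \<le> 2 / \<rho>" using r by simp
  qed
  finally show ?thesis .
qed

end

section \<open>Error recursions\<close>

text \<open>Each step bounds \<open>c * a t\<close> by \<open>a t - a (Suc t) + b t\<close>, and the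
  differences telescope. The induction keeps the final term \<open>a T\<close>, which is dropped
  only at the end.\<close>

lemma sum_contraction:
  fixes a b :: "nat \<Rightarrow> real"
  assumes step: "\<And>t. a (Suc t) \<le> (1 - c) * a t + b t" and nonneg: "\<And>t. 0 \<le> a t"
  shows "c * (\<Sum>t<T. a t) \<le> a 0 + (\<Sum>t<T. b t)"
proof -
  have "c * (\<Sum>t<T. a t) + a T \<le> a 0 + (\<Sum>t<T. b t)"
  proof (induction T)
    case (Suc T)
    then show ?case using step[of T] by (simp add: algebra_simps)
  qed simp
  then show ?thesis using nonneg[of T] by linarith
qed

text \<open>Here \<open>Q\<close>, \<open>R\<close>, \<open>S\<close>, \<open>V\<close>, \<Delta>
  stand for sums over time, \<open>q\<close>, \<open>r\<close>, \<delta> for initial values,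
  \<open>k\<close> for \<kappa> and \<open>u\<close> for the squared stepsize in \<open>x\<close>.
  The summed recursions form a loop: \<open>Q\<close> depends on \<open>R\<close>, \<open>R\<close>
  on \<open>Q\<close> and \<open>S\<close>, and \<open>S\<close> on \<open>Q\<close>. Eliminating
  \<open>R\<close> and \<open>S\<close> closes it on \<open>Q\<close>, after which \<Delta> is
  bounded by \<open>Deq\<close>. The energy \<open>V\<close> remains with coefficient 1/2, which the
  descent inequality can absorb.\<close>

lemma accumulated_error_bound:
  fixes L k a \<rho> u Q R S V \<Delta> q r \<delta> :: real
  assumes pos: "L > 0" "k \<ge> 1" "a > 0" "18 * a \<le> 1" "0 < \<rho>" "\<rho> \<le> 1" "u \<ge> 0"
    and nn: "Q \<ge> 0" "R \<ge> 0" "S \<ge> 0" "V \<ge> 0" "q \<ge> 0" "r \<ge> 0" "\<delta> \<ge> 0"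
    and Deq: "a * \<Delta> + 7 / 9 * S \<le> \<delta> + 2 * a * k\<^sup>2 * Q + 3 / a * k\<^sup>2 * u * V"
    and Qeq: "\<rho> / 2 * Q \<le> q + 2 / \<rho> * u * R"
    and Req: "\<rho> / 2 * R \<le> r + 4 * L\<^sup>2 / \<rho> * (4 * Q + 4 * u / \<rho> * R + u * V + S)"
    and \<Delta>: "\<Delta> \<ge> 0"
    and u1: "43200 * k\<^sup>2 * L\<^sup>2 * u \<le> \<rho> ^ 4"
    and u2: "300 * L\<^sup>2 * k\<^sup>2 * u \<le> a\<^sup>2"
    and u3: "100000 * L ^ 4 * k ^ 4 * u\<^sup>2 \<le> a * \<rho> ^ 4"
  shows "2 * L\<^sup>2 * (Q + \<Delta>) \<le> 600 * k\<^sup>2 * L\<^sup>2 * q / \<rho> + 16 * L\<^sup>2 * \<delta> / a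
    + 4800 * u * k\<^sup>2 * L\<^sup>2 * r / \<rho> ^ 3 + V / 2"
proof -
  \<comment> \<open>The gain of the loop is governed by \<open>w\<close>. The primed quantities are
    scaled to be comparable with \<open>Q\<close>, and \<open>H\<close> is the form in which
    \<open>V\<close> enters \<open>S\<close>.\<close>
  define w where "w = L\<^sup>2 * u / \<rho> ^ 4"
  define R' where "R' = 4 * u / \<rho>\<^sup>2 * R"
  define H where "H = k\<^sup>2 * u * V / a"
  define q' where "q' = 2 * q / \<rho>"
  define r' where "r' = 8 * u * r / \<rho> ^ 3"
  have nn': "w \<ge> 0" "R' \<ge> 0" "H \<ge> 0" "q' \<ge> 0" "r' \<ge> 0"
    using pos nn by (auto simp: w_def R'_def H_def q'_def r'_def)
  have k2: "1 \<le> k\<^sup>2" using pos by simp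
  have "43200 * (k\<^sup>2 * w) \<le> 1" using u1 pos by (simp add: w_def field_simps)
  then have kw: "k\<^sup>2 * w \<le> 1 / 43200" by simp
  have "1 * w \<le> k\<^sup>2 * w" using nn' k2 by (intro mult_right_mono) auto
  then have w: "w \<le> 1 / 43200" using kw by simp
  have Q: "Q \<le> q' + R'"
  proof -
    have "2 / \<rho> * (\<rho> / 2 * Q) \<le> 2 / \<rho> * (q + 2 / \<rho> * u * R)"
      using Qeq pos by (intro mult_left_mono) auto
    then show ?thesis using pos by (simp add: q'_def R'_def field_simps power2_eq_square)
  qed
  have R1: "R' \<le> r' + 32 * (w * (4 * Q + \<rho> * R' + u * V + S))"
  proof -
    have "8 * u / \<rho> ^ 3 * (\<rho> / 2 * R)
        \<le> 8 * u / \<rho> ^ 3 * (r + 4 * L\<^sup>2 / \<rho> * (4 * Q + 4 * u / \<rho> * R + u * V + S))"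
      using Req pos by (intro mult_left_mono) auto
    moreover have "8 * u / \<rho> ^ 3 * (\<rho> / 2 * R) = R'"
      using pos by (simp add: R'_def power2_eq_square power3_eq_cube)
    moreover have "8 * u / \<rho> ^ 3 * (r + 4 * L\<^sup>2 / \<rho> * Z) = r' + 32 * (w * Z)" for Z
      using pos by (simp add: r'_def w_def field_simps power_numeral_reduce)
    moreover have "4 * u / \<rho> * R = \<rho> * R'"
      using pos by (simp add: R'_def power2_eq_square)
    ultimately show ?thesis by simp
  qed
  have uV: "u * V \<le> H"
  proof -
    have "a \<le> k\<^sup>2" using pos k2 by linarith
    then have "u * V * a \<le> u * V * k\<^sup>2" using pos nn by (intro mult_left_mono) auto
    then show ?thesis using pos by (simp add: H_def field_simps)
  qed
  \<comment> \<open>After dropping \<open>a * \<Delta>\<close>, the bound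
    \<open>18 * a \<le> 1\<close> gives the coefficient 9/7 * 2/18 = 1/7, and 9/7 * 3 is rounded up
    to 4.\<close>
  have S: "S \<le> 9 / 7 * \<delta> + 1 / 7 * (k\<^sup>2 * Q) + 4 * H"
  proof -
    have "a * (k\<^sup>2 * Q) \<le> 1 / 18 * (k\<^sup>2 * Q)" using pos nn by (intro mult_right_mono) auto
    moreover have "0 \<le> a * \<Delta>" using pos \<Delta> by simp
    moreover have "3 / a * k\<^sup>2 * u * V = 3 * H" "2 * a * k\<^sup>2 * Q = 2 * (a * (k\<^sup>2 * Q))"
      by (simp_all add: H_def)
    then have "a * \<Delta> + 7 / 9 * S \<le> \<delta> + 2 * (a * (k\<^sup>2 * Q)) + 3 * H"
      using Deq by (simp only:)
    ultimately show ?thesis using nn' by linarith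
  qed
  \<comment> \<open>Linear elimination with products as atoms: \<open>A\<close>, \<open>B\<close>,
    \<open>C\<close>, \<open>D\<close> will be \<open>Q\<close>, \<open>R'\<close>,
    \<open>w * H\<close>, \<open>w * \<delta>\<close>. With \<open>w\<close> and
    \<open>k\<^sup>2 * w\<close> replaced by 1/43200, the feedback is absorbed on the left.\<close>
  have lin: "A \<le> 3 / 2 * (q' + r') + 200 * C + 200 * D"
    if "B \<le> r' + 128 * (1 / 43200 * A) + 32 * (1 / 43200 * B) + 160 * C + 288 / 7 * D + 32 / 7 * (1 / 43200 * A)"
      "A \<le> q' + B" "0 \<le> A" "0 \<le> B" "0 \<le> q'" "0 \<le> r'" "0 \<le> C" "0 \<le> D" for A B C D
    using that by argo
  have "R' \<le> r' + 32 * (w * (4 * Q + R' + H + (9 / 7 * \<delta> + 1 / 7 * (k\<^sup>2 * Q) + 4 * H)))"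
  proof -
    have "\<rho> * R' \<le> 1 * R'" using pos nn' by (intro mult_right_mono) auto
    then have "w * (4 * Q + \<rho> * R' + u * V + S)
        \<le> w * (4 * Q + R' + H + (9 / 7 * \<delta> + 1 / 7 * (k\<^sup>2 * Q) + 4 * H))"
      using uV S nn' by (intro mult_left_mono) auto
    then show ?thesis using R1 by linarith
  qed
  also have "\<dots> = r' + 128 * (w * Q) + 32 * (w * R') + 160 * (w * H) + 288 / 7 * (w * \<delta>) + 32 / 7 * (k\<^sup>2 * w * Q)"
    by (simp add: algebra_simps)
  also have "\<dots> \<le> r' + 128 * (1 / 43200 * Q) + 32 * (1 / 43200 * R') + 160 * (w * H) + 288 / 7 * (w * \<delta>)
      + 32 / 7 * (1 / 43200 * Q)"
    using w kw nn nn' by (intro add_mono mult_left_mono mult_right_mono order_refl) auto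
  finally have Q2: "Q \<le> 3 / 2 * (q' + r') + 200 * (w * H) + 200 * (w * \<delta>)"
    using lin Q nn(1) nn' mult_nonneg_nonneg[OF nn'(1) nn'(3)] mult_nonneg_nonneg[OF nn'(1) nn(7)] by blast
  have Ds: "\<Delta> \<le> \<delta> / a + 2 * (k\<^sup>2 * Q) + 3 * H / a"
  proof -
    have "a * \<Delta> \<le> \<delta> + 2 * a * k\<^sup>2 * Q + 3 * H" using Deq nn by (simp add: H_def)
    then show ?thesis using pos by (simp add: field_simps)
  qed
  have QQ: "Q \<le> k\<^sup>2 * Q" using nn k2 by (simp add: mult_le_cancel_right1)
  have "2 * L\<^sup>2 * (Q + \<Delta>) \<le> 2 * L\<^sup>2 * (\<delta> / a + 3 * H / a + 3 * (k\<^sup>2 * Q))"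
    using Ds QQ pos by (intro mult_left_mono) auto
  also have "\<dots> \<le> 2 * L\<^sup>2 * (\<delta> / a + 3 * H / a
      + 3 * (k\<^sup>2 * (3 / 2 * (q' + r') + 200 * (w * H) + 200 * (w * \<delta>))))"
    using Q2 pos by (intro mult_left_mono add_mono order_refl) auto
  also have "\<dots> = 2 * (L\<^sup>2 * \<delta> / a) + 6 * (L\<^sup>2 * H / a) + 9 * (k\<^sup>2 * L\<^sup>2 * q') + 9 * (k\<^sup>2 * L\<^sup>2 * r')
      + 1200 * (L\<^sup>2 * k\<^sup>2 * w * H) + 1200 * (L\<^sup>2 * ((k\<^sup>2 * w) * \<delta>))"
    by (simp add: algebra_simps)
  also have "\<dots> \<le> 16 * (L\<^sup>2 * \<delta> / a) + V / 2 + 600 * (k\<^sup>2 * L\<^sup>2 * q / \<rho>) + 4800 * (k\<^sup>2 * L\<^sup>2 * u * r / \<rho> ^ 3)"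
  proof -
    \<comment> \<open>Condition \<open>u2\<close> controls the mean-gradient energy that enters
      through \<Delta> directly, and \<open>u3\<close> the part that enters through
      \<open>Q\<close>; the initial error \<delta> inside \<open>Q\<close> is controlled by
      \<open>u1\<close>.\<close>
    have "L\<^sup>2 * H / a \<le> V / 300"
    proof -
      have "300 * (L\<^sup>2 * k\<^sup>2 * u) * V \<le> a\<^sup>2 * V" using u2 nn by (intro mult_right_mono) auto
      then show ?thesis using pos by (simp add: H_def field_simps power2_eq_square)
    qed
    moreover have "L\<^sup>2 * k\<^sup>2 * w * H \<le> V / 100000"
    proof -
      have "100000 * L ^ 4 * k ^ 4 * u\<^sup>2 * V \<le> a * \<rho> ^ 4 * V" using u3 nn by (intro mult_right_mono) auto
      then show ?thesis
        using pos by (simp add: H_def w_def field_simps power2_eq_square power4_eq_xxxx)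
    qed
    moreover have "(k\<^sup>2 * w) * \<delta> \<le> 1 / 100 * (\<delta> / a)"
    proof -
      have "(k\<^sup>2 * w) * \<delta> \<le> 1 / 100 * \<delta>" using kw nn by (intro mult_right_mono) auto
      also have "\<delta> \<le> \<delta> / a" using pos nn by (simp add: field_simps mult_left_le)
      finally show ?thesis by simp
    qed
    then have "L\<^sup>2 * ((k\<^sup>2 * w) * \<delta>) \<le> L\<^sup>2 * (1 / 100 * (\<delta> / a))" by (intro mult_left_mono) auto
    then have "L\<^sup>2 * ((k\<^sup>2 * w) * \<delta>) \<le> 1 / 100 * (L\<^sup>2 * \<delta> / a)" by simp
    moreover have "9 * (k\<^sup>2 * L\<^sup>2 * q') = 18 * (k\<^sup>2 * L\<^sup>2 * q / \<rho>)"
      "9 * (k\<^sup>2 * L\<^sup>2 * r') = 72 * (k\<^sup>2 * L\<^sup>2 * u * r / \<rho> ^ 3)"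
      by (simp_all add: q'_def r'_def)
    moreover have "0 \<le> k\<^sup>2 * L\<^sup>2 * q / \<rho>" "0 \<le> k\<^sup>2 * L\<^sup>2 * u * r / \<rho> ^ 3" "0 \<le> L\<^sup>2 * \<delta> / a"
      using pos nn by auto
    \<comment> \<open>The \<open>V\<close> terms amount to 6/300 + 1200/100000, below 1/2, and the
      terms in \<open>A\<close> to 2 + 12, below 16.\<close>
    moreover have "2 * A + 6 * B + A1 + A2 + 1200 * B1 + 1200 * B2 \<le> 16 * A + V / 2 + 600 * A3 + 4800 * A4"
      if "B \<le> V / 300" "B1 \<le> V / 100000" "B2 \<le> 1 / 100 * A" "A1 = 18 * A3" "A2 = 72 * A4"
        "0 \<le> A3" "0 \<le> A4" "0 \<le> A" "0 \<le> V" for A B A1 A2 B1 B2 A3 A4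
      using that by argo
    ultimately show ?thesis using nn(4) by blast
  qed
  finally show ?thesis by (simp add: mult.assoc mult.commute mult.left_commute)
qed

lemma power2_le_double:
  fixes z :: "'a::real_normed_vector"
  assumes "norm z \<le> L * (b + c)"
  shows "(norm z)\<^sup>2 \<le> 2 * L\<^sup>2 * (b\<^sup>2 + c\<^sup>2)"
proof -
  have "(norm z)\<^sup>2 \<le> (L * (b + c))\<^sup>2" using assms by (intro power_mono) auto
  also have "\<dots> = L\<^sup>2 * (b + c)\<^sup>2" by (rule power_mult_distrib)
  also have "\<dots> \<le> L\<^sup>2 * (2 * (b\<^sup>2 + c\<^sup>2))"
    using sum_squares_bound[of b c] by (intro mult_left_mono) (auto simp: power2_sum)
  finally show ?thesis by (simp only: mult.left_commute mult.assoc)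
qed

section \<open>The iterates of the algorithm and their one-step recursions\<close>

locale dgta_run = network n E W
  for n :: nat and E :: "(nat \<times> nat) set" and W :: "nat \<Rightarrow> nat \<Rightarrow> real" +
  fixes d :: nat and p :: "nat \<Rightarrow> nat"
    and f :: "nat \<Rightarrow> fvec \<times> fvec \<Rightarrow> real" and G :: "nat \<Rightarrow> fvec \<times> fvec \<Rightarrow> fvec \<times> fvec"
    and Y :: "nat \<Rightarrow> fvec set" and L \<mu> \<eta>x \<eta>y :: real and x0 y0 :: "nat \<Rightarrow> fvec"
  assumes lam_less: "lam < 1"
    and agents: "i < n \<Longrightarrow> agent d (p i) (Y i) (f i) (G i) L \<mu>"
    and mu_L: "\<mu> \<le> L"
    and x0: "i < n \<Longrightarrow> x0 i \<in> euclid d" and y0: "i < n \<Longrightarrow> y0 i \<in> Y i"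
    and etax_pos: "\<eta>x > 0" and etay_pos: "\<eta>y > 0" and etay_le: "9 * \<eta>y * (L + \<mu>) \<le> 1"
begin

definition x where "x t = dgta_x E W Y G \<eta>x \<eta>y x0 y0 t"
definition y where "y t = fst (snd (dgta E W Y G \<eta>x \<eta>y x0 y0 t))"
definition g where "g t = snd (snd (dgta E W Y G \<eta>x \<eta>y x0 y0 t))"
definition h where "h t i = fst (G i (x t i, y t i))"
definition xbar where "xbar t = avg n (x t)"
definition gbar where "gbar t = avg n (g t)"
definition ys where "ys i z = agent.ystar (Y i) (f i) z"
definition grad\<Phi> where "grad\<Phi> z = avg n (\<lambda>i. fst (G i (z, ys i z)))"
definition \<rho> where "\<rho> = 1 - lam\<^sup>2"
definition u where "u = \<eta>x\<^sup>2"
definition a where "a = \<eta>y * \<mu>"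
definition \<kappa> where "\<kappa> = L / \<mu>"
definition q where "q t = deviation n (x t)"
definition r where "r t = deviation n (g t)"
definition s where "s t = (\<Sum>i<n. (norm (y (Suc t) i - y t i))\<^sup>2)"
definition \<delta> where "\<delta> t = (\<Sum>i<n. (norm (y t i - ys i (xbar t)))\<^sup>2)"
definition v where "v t = real n * (norm (gbar t))\<^sup>2"

lemma L_pos: "L > 0" and mu_pos: "\<mu> > 0"
  using agents[of 0] n by (auto simp: agent_def)

lemma kappa_ge1: "1 \<le> \<kappa>"
  using mu_L mu_pos by (simp add: \<kappa>_def)

lemma rho_bounds: "0 < \<rho>" "\<rho> \<le> 1"
proof -
  have "lam\<^sup>2 < 1"
    using lam_less spectral_norm_nonneg[of n "\<lambda>i j. W i j - 1 / real n"] by (simp add: power_less_one_iff)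
  then show "0 < \<rho>" "\<rho> \<le> 1" by (auto simp: \<rho>_def)
qed

lemma etay_L: "9 * (\<eta>y * L) \<le> 1"
proof -
  have "0 < \<eta>y * \<mu>" using etay_pos mu_pos by simp
  then show ?thesis using etay_le by (simp add: algebra_simps)
qed

lemma a_bounds: "0 < a" "18 * a \<le> 1"
proof -
  show "0 < a" using etay_pos mu_pos by (simp add: a_def)
  have "\<eta>y * \<mu> \<le> \<eta>y * L" using etay_pos mu_L by simp
  then show "18 * a \<le> 1" using etay_le by (simp add: a_def algebra_simps)
qed

lemma x_0: "x 0 = x0" and y_0: "y 0 = y0" and g_0: "g 0 = h 0"
  by (auto simp: x_def y_def g_def h_def dgta_x_def fun_eq_iff)

lemma x_Suc: "x (Suc t) = mix E W (\<lambda>j. x t j + (- \<eta>x) *\<^sub>R g t j)"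
  by (simp add: x_def g_def dgta_x_def mix_def fun_eq_iff case_prod_unfold Let_def)

lemma y_Suc: "y (Suc t) i = proj (Y i) (y t i + \<eta>y *\<^sub>R snd (G i (x t i, y t i)))"
  by (simp add: x_def y_def dgta_x_def case_prod_unfold Let_def)

lemma g_Suc: "g (Suc t) = mix E W (\<lambda>j. g t j + (h (Suc t) j - h t j))"
  by (simp add: x_def y_def g_def h_def dgta_x_def mix_def fun_eq_iff case_prod_unfold Let_def add_diff_eq)

lemma mix_in: "(\<And>j. j < n \<Longrightarrow> X j \<in> euclid d) \<Longrightarrow> mix E W X i \<in> euclid d"
  unfolding mix_def using neighbours
  by (intro subspace_sum subspace_euclid subspace_scale[OF subspace_euclid]) blast

lemma avg_in: "(\<And>j. j < n \<Longrightarrow> X j \<in> euclid d) \<Longrightarrow> avg n X \<in> euclid d"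
  unfolding avg_def
  by (intro subspace_sum subspace_euclid subspace_scale[OF subspace_euclid]) auto

lemma y_in: "i < n \<Longrightarrow> y t i \<in> Y i"
proof (induction t)
  case (Suc t)
  then interpret agent d "p i" "Y i" "f i" "G i" L \<mu> by (intro agents)
  show ?case unfolding y_Suc by (rule proj_closest(1)[OF Y_comp Y_ne])
qed (simp add: y_0 y0)

text \<open>The two claims are proved jointly, since each new \<open>x\<close> uses the old
  \<open>g\<close> and each new \<open>g\<close> uses the new \<open>x\<close>.\<close>

lemma x_g_in: "(\<forall>i<n. x t i \<in> euclid d) \<and> (\<forall>i<n. g t i \<in> euclid d)"
proof (induction t)
  case 0
  show ?case using agent.gx_in[OF agents] x0 y0 by (simp add: x_0 g_0 y_0 h_def)
next
  case (Suc t)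
  have x: "x (Suc t) i \<in> euclid d" for i
    unfolding x_Suc using Suc
    by (intro mix_in subspace_add[OF subspace_euclid] subspace_scale[OF subspace_euclid]) auto
  have h: "h (Suc t) i \<in> euclid d" "h t i \<in> euclid d" if "i < n" for i
    unfolding h_def using agent.gx_in[OF agents] x y_in Suc that by blast+
  have "g (Suc t) i \<in> euclid d" for i
    unfolding g_Suc using Suc h
    by (intro mix_in subspace_add[OF subspace_euclid] subspace_diff[OF subspace_euclid]) auto
  then show ?case using x by blast
qed

lemma x_in: "i < n \<Longrightarrow> x t i \<in> euclid d"
  using x_g_in by blast

lemma xbar_in: "xbar t \<in> euclid d"
  unfolding xbar_def by (intro avg_in x_in)

lemma ys_in: "i < n \<Longrightarrow> z \<in> euclid d \<Longrightarrow> ys i z \<in> Y i"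
  unfolding ys_def by (rule agent.ystar_in[OF agents])

text \<open>Gradient tracking: mixing preserves means and the added increments of \<open>h\<close>
  telescope, so the initialisation \<open>g 0 = h 0\<close> persists.\<close>

lemma gbar_eq: "gbar t = avg n (h t)"
  unfolding gbar_def
  by (induction t) (simp_all add: g_0 g_Suc avg_mix avg_add avg_diff)

lemma xbar_Suc: "xbar (Suc t) = xbar t - \<eta>x *\<^sub>R gbar t"
  unfolding xbar_def gbar_def by (simp only: x_Suc avg_mix avg_add avg_scaleR) simp

lemma nonneg: "0 \<le> q t" "0 \<le> r t" "0 \<le> s t" "0 \<le> \<delta> t" "0 \<le> v t" "0 \<le> u"
  by (simp_all add: q_def r_def s_def \<delta>_def v_def u_def deviation_nonneg sum_nonneg)

lemma q_step: "q (Suc t) \<le> (1 - \<rho> / 2) * q t + 2 / \<rho> * u * r t"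
proof -
  have "q (Suc t) \<le> (1 - \<rho> / 2) * q t + 2 / \<rho> * deviation n (\<lambda>j. (- \<eta>x) *\<^sub>R g t j)"
    unfolding q_def x_Suc by (rule deviation_mix_add_le[OF lam_less \<rho>_def])
  then show ?thesis by (simp add: deviation_scaleR r_def u_def mult.assoc del: scaleR_minus_left)
qed

text \<open>The increment splits into its deviation and its mean. The deviation is at most
  \<open>2 * q (Suc t) + 2 * q t\<close>, where \<open>q_step\<close> removes the later term; the
  mean moves by exactly \<open>\<eta>x *\<^sub>R gbar t\<close>.\<close>

lemma x_increment: "(\<Sum>i<n. (norm (x (Suc t) i - x t i))\<^sup>2) \<le> 4 * q t + 4 * u / \<rho> * r t + u * v t"
proof -
  have 1: "deviation n (\<lambda>i. x (Suc t) i - x t i) \<le> 2 * q (Suc t) + 2 * q t"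
    using deviation_add_le[of 1 n "x (Suc t)" "\<lambda>i. (- 1) *\<^sub>R x t i"] deviation_scaleR[of n "- 1" "x t"]
    by (simp add: q_def)
  have 2: "q (Suc t) \<le> q t + 2 / \<rho> * u * r t"
    using q_step[of t] mult_right_mono[of "1 - \<rho> / 2" 1 "q t"] rho_bounds nonneg(1)[of t] by linarith
  have "(\<Sum>i<n. (norm (x (Suc t) i - x t i))\<^sup>2)
      = deviation n (\<lambda>i. x (Suc t) i - x t i) + real n * (norm (xbar (Suc t) - xbar t))\<^sup>2"
    using sum_power2_norm_eq[OF n, of "\<lambda>i. x (Suc t) i - x t i"] by (simp add: avg_diff xbar_def)
  also have "real n * (norm (xbar (Suc t) - xbar t))\<^sup>2 = u * v t"
    by (simp add: xbar_Suc u_def v_def power_mult_distrib)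
  finally show ?thesis using 1 2 by simp
qed

text \<open>The perturbation of the trackers is the change of the local gradients, bounded by
  smoothness. The factor 4 is 2 from mixing times 2 from squaring a sum.\<close>

lemma r_step: "r (Suc t) \<le> (1 - \<rho> / 2) * r t
  + 4 * L\<^sup>2 / \<rho> * (4 * q t + 4 * u / \<rho> * r t + u * v t + s t)"
proof -
  define Z where "Z = 4 * q t + 4 * u / \<rho> * r t + u * v t + s t"
  have "deviation n (\<lambda>j. h (Suc t) j - h t j) \<le> (\<Sum>i<n. (norm (h (Suc t) i - h t i))\<^sup>2)"
    by (rule deviation_le[OF n])
  also have "\<dots> \<le> (\<Sum>i<n. 2 * L\<^sup>2 * ((norm (x (Suc t) i - x t i))\<^sup>2 + (norm (y (Suc t) i - y t i))\<^sup>2))"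
    unfolding h_def by (intro sum_mono power2_le_double agent.gx_lip[OF agents] x_in y_in) auto
  also have "\<dots> = 2 * L\<^sup>2 * ((\<Sum>i<n. (norm (x (Suc t) i - x t i))\<^sup>2) + s t)"
    by (simp only: s_def sum_distrib_left sum.distrib distrib_left)
  also have "\<dots> \<le> 2 * L\<^sup>2 * Z"
    unfolding Z_def by (intro mult_left_mono add_mono x_increment) auto
  finally have "2 / \<rho> * deviation n (\<lambda>j. h (Suc t) j - h t j) \<le> 2 / \<rho> * (2 * L\<^sup>2 * Z)"
    using rho_bounds by (intro mult_left_mono) auto
  also have "\<dots> = 4 * L\<^sup>2 / \<rho> * Z" by simp
  finally have 1: "2 / \<rho> * deviation n (\<lambda>j. h (Suc t) j - h t j) \<le> 4 * L\<^sup>2 / \<rho> * Z" .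
  have 2: "r (Suc t) \<le> (1 - \<rho> / 2) * r t + 2 / \<rho> * deviation n (\<lambda>j. h (Suc t) j - h t j)"
    unfolding r_def g_Suc by (rule deviation_mix_add_le[OF lam_less \<rho>_def])
  show ?thesis unfolding Z_def[symmetric] by (rule order_trans[OF 2 add_left_mono[OF 1]])
qed

text \<open>\<open>ascent_step\<close> is applied with the mean as reference point and the local
  iterate as the point of the gradient. Moving the maximiser from \<open>xbar t\<close> to
  \<open>xbar (Suc t)\<close> uses Young's inequality with weight \<open>a / 2\<close>, matching the
  factor \<open>1 + a / 2\<close> which that lemma has on the left.\<close>

lemma \<delta>_step: "\<delta> (Suc t) \<le> (1 - a) * \<delta> t + (2 * a * \<kappa>\<^sup>2 * q t + 3 / a * \<kappa>\<^sup>2 * u * v t - 7 / 9 * s t)"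
proof -
  have "(norm (y (Suc t) i - ys i (xbar (Suc t))))\<^sup>2
      \<le> (1 - a) * (norm (y t i - ys i (xbar t)))\<^sup>2 + 2 * a * \<kappa>\<^sup>2 * (norm (x t i - xbar t))\<^sup>2
        + 3 / a * \<kappa>\<^sup>2 * u * (norm (gbar t))\<^sup>2 - 7 / 9 * (norm (y (Suc t) i - y t i))\<^sup>2" if i: "i < n" for i
  proof -
    interpret agent d "p i" "Y i" "f i" "G i" L \<mu> by (rule agents[OF i])
    have step: "(1 + a / 2) * (norm (y (Suc t) i - ys i (xbar t)))\<^sup>2 + (1 - 2 * \<eta>y * L) * (norm (y (Suc t) i - y t i))\<^sup>2
        \<le> (1 - a) * (norm (y t i - ys i (xbar t)))\<^sup>2 + 2 * \<eta>y * L\<^sup>2 / \<mu> * (norm (x t i - xbar t))\<^sup>2"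
      using ascent_step[OF xbar_in[of t] x_in[OF i, of t] y_in[OF i, of t] etay_pos] by (simp only: y_Suc ys_def a_def)
    have eq: "2 * \<eta>y * L\<^sup>2 / \<mu> = 2 * a * \<kappa>\<^sup>2"
      using mu_pos by (simp add: a_def \<kappa>_def power2_eq_square)
    from step have "(1 + a / 2) * (norm (y (Suc t) i - ys i (xbar t)))\<^sup>2 + (1 - 2 * \<eta>y * L) * (norm (y (Suc t) i - y t i))\<^sup>2
        \<le> (1 - a) * (norm (y t i - ys i (xbar t)))\<^sup>2 + 2 * a * \<kappa>\<^sup>2 * (norm (x t i - xbar t))\<^sup>2"
      unfolding eq .
    \<comment> \<open>By \<open>9 * (\<eta>y * L) \<le> 1\<close> at least 7/9 of the squared
      \<open>y\<close>-step survives as a negative term.\<close>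
    moreover have "7 / 9 * (norm (y (Suc t) i - y t i))\<^sup>2 \<le> (1 - 2 * \<eta>y * L) * (norm (y (Suc t) i - y t i))\<^sup>2"
      using etay_L by (intro mult_right_mono) (simp_all add: mult.commute)
    moreover have "(norm (y (Suc t) i - ys i (xbar (Suc t))))\<^sup>2
        \<le> (1 + a / 2) * (norm (y (Suc t) i - ys i (xbar t)))\<^sup>2
          + (1 + 1 / (a / 2)) * (norm (ys i (xbar t) - ys i (xbar (Suc t))))\<^sup>2"
      using a_bounds power2_norm_add_le[of "a / 2" "y (Suc t) i - ys i (xbar t)" "ys i (xbar t) - ys i (xbar (Suc t))"]
      by simp
    moreover have "(1 + 1 / (a / 2)) * (norm (ys i (xbar t) - ys i (xbar (Suc t))))\<^sup>2
        \<le> 3 / a * (\<kappa>\<^sup>2 * u * (norm (gbar t))\<^sup>2)" (is "?lhs \<le> _")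
    proof (rule mult_mono)
      show "1 + 1 / (a / 2) \<le> 3 / a" using a_bounds by (simp add: field_simps)
      have "norm (ys i (xbar t) - ys i (xbar (Suc t))) \<le> \<kappa> * norm (xbar t - xbar (Suc t))"
        unfolding ys_def \<kappa>_def by (rule ystar_lip[OF xbar_in xbar_in])
      also have "\<dots> = \<kappa> * (\<eta>x * norm (gbar t))" using etax_pos by (simp add: xbar_Suc)
      finally have "(norm (ys i (xbar t) - ys i (xbar (Suc t))))\<^sup>2 \<le> (\<kappa> * (\<eta>x * norm (gbar t)))\<^sup>2"
        by (rule power_mono) simp
      then show "(norm (ys i (xbar t) - ys i (xbar (Suc t))))\<^sup>2 \<le> \<kappa>\<^sup>2 * u * (norm (gbar t))\<^sup>2"
        by (simp add: power_mult_distrib u_def)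
    qed (use a_bounds in auto)
    then have "?lhs \<le> 3 / a * \<kappa>\<^sup>2 * u * (norm (gbar t))\<^sup>2" by (simp only: mult.assoc)
    ultimately show ?thesis by linarith
  qed
  then have "\<delta> (Suc t) \<le> (\<Sum>i<n. (1 - a) * (norm (y t i - ys i (xbar t)))\<^sup>2 + 2 * a * \<kappa>\<^sup>2 * (norm (x t i - xbar t))\<^sup>2
        + 3 / a * \<kappa>\<^sup>2 * u * (norm (gbar t))\<^sup>2 - 7 / 9 * (norm (y (Suc t) i - y t i))\<^sup>2)"
    unfolding \<delta>_def by (intro sum_mono) simp
  also have "\<dots> = (1 - a) * \<delta> t + (2 * a * \<kappa>\<^sup>2 * q t + 3 / a * \<kappa>\<^sup>2 * u * v t - 7 / 9 * s t)"
    unfolding \<delta>_def q_def deviation_def s_def v_def xbar_def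
    by (simp add: sum.distrib sum_subtractf sum_distrib_left mult.assoc mult.left_commute)
  finally show ?thesis .
qed

section \<open>The averaged maximum function along the mean trajectory\<close>

lemma Phi_linearization:
  assumes z: "z \<in> euclid d" "z' \<in> euclid d"
  shows "\<bar>Phi n f Y z' - Phi n f Y z - grad\<Phi> z \<bullet> (z' - z)\<bar> \<le> L * (1 + \<kappa>) * (norm (z' - z))\<^sup>2"
proof -
  define e where "e i = (SUP y\<in>Y i. f i (z', y)) - (SUP y\<in>Y i. f i (z, y)) - fst (G i (z, ys i z)) \<bullet> (z' - z)" for i
  have "Phi n f Y z' - Phi n f Y z - grad\<Phi> z \<bullet> (z' - z) = (1 / real n) * (\<Sum>i<n. e i)"
    by (simp add: Phi_def grad\<Phi>_def avg_def e_def sum_subtractf inner_sum_left diff_divide_distrib)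
  also have "\<bar>\<dots>\<bar> \<le> (1 / real n) * (\<Sum>i<n. \<bar>e i\<bar>)"
    unfolding abs_mult by (intro mult_mono sum_abs) auto
  also have "\<dots> \<le> (1 / real n) * (\<Sum>i<n. L * (1 + \<kappa>) * (norm (z' - z))\<^sup>2)"
    unfolding e_def \<kappa>_def ys_def
    by (intro mult_left_mono sum_mono agent.danskin[OF agents] z) auto
  also have "\<dots> = L * (1 + \<kappa>) * (norm (z' - z))\<^sup>2" using n by simp
  finally show ?thesis .
qed

text \<open>The quadratic linearisation error identifies the gradient of the statement with the mean
  of the agents' gradients at their maximisers.\<close>

lemma gradient_Phi: "z \<in> euclid d \<Longrightarrow> gradient_on (euclid d) (Phi n f Y) z = grad\<Phi> z"
proof (rule gradient_on_eqI[OF subspace_euclid])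
  assume z: "z \<in> euclid d"
  show "grad\<Phi> z \<in> euclid d"
    unfolding grad\<Phi>_def by (intro avg_in agent.gx_in[OF agents] ys_in z)
  show "(Phi n f Y has_derivative (\<bullet>) (grad\<Phi> z)) (at z within euclid d)"
    by (rule has_derivative_quadratic_error[OF Phi_linearization[OF z]])
qed

text \<open>Both vectors are means of local gradients, taken at the mean point with its maximisers
  and at the iterates respectively. Convexity of the squared norm and smoothness reduce the error to
  \<open>q\<close> and \<delta>.\<close>

lemma gradient_error:
  "real n * (norm (grad\<Phi> (xbar t) - gbar t))\<^sup>2 \<le> 2 * L\<^sup>2 * (q t + \<delta> t)"
proof -
  have "grad\<Phi> (xbar t) - gbar t = avg n (\<lambda>i. fst (G i (xbar t, ys i (xbar t))) - h t i)"
    by (simp add: grad\<Phi>_def gbar_eq avg_diff)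
  then have "real n * (norm (grad\<Phi> (xbar t) - gbar t))\<^sup>2
      \<le> (\<Sum>i<n. (norm (fst (G i (xbar t, ys i (xbar t))) - h t i))\<^sup>2)"
    using norm_avg_le[OF n, of "\<lambda>i. fst (G i (xbar t, ys i (xbar t))) - h t i"] by simp
  also have "\<dots> \<le> (\<Sum>i<n. 2 * L\<^sup>2 * ((norm (xbar t - x t i))\<^sup>2 + (norm (ys i (xbar t) - y t i))\<^sup>2))"
    unfolding h_def
    by (intro sum_mono power2_le_double agent.gx_lip[OF agents] xbar_in x_in y_in ys_in) auto
  also have "\<dots> = 2 * L\<^sup>2 * (q t + \<delta> t)"
    by (simp add: q_def deviation_def \<delta>_def xbar_def sum_distrib_left[symmetric] sum.distrib norm_minus_commute)
  finally show ?thesis .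
qed

text \<open>The cross term of the quadratic estimate is rewritten by polarisation, which yields the
  full negative energy of \<open>gbar\<close>. The second-order term uses up half of it, and the
  other half stays available for the accumulated errors.\<close>

lemma descent:
  assumes small: "8 * \<kappa> * L * \<eta>x \<le> 1"
  shows "real n * (norm (grad\<Phi> (xbar t)))\<^sup>2
    \<le> 2 * real n / \<eta>x * (Phi n f Y (xbar t) - Phi n f Y (xbar (Suc t))) + 2 * L\<^sup>2 * (q t + \<delta> t) - v t / 2"
proof -
  let ?g = "grad\<Phi> (xbar t)"
  have "Phi n f Y (xbar (Suc t)) - Phi n f Y (xbar t) - ?g \<bullet> (xbar (Suc t) - xbar t)
      \<le> L * (1 + \<kappa>) * (norm (xbar (Suc t) - xbar t))\<^sup>2"
    using Phi_linearization[OF xbar_in xbar_in] abs_le_D1 by blast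
  then have "Phi n f Y (xbar (Suc t)) - Phi n f Y (xbar t)
      \<le> L * (1 + \<kappa>) * (\<eta>x\<^sup>2 * (norm (gbar t))\<^sup>2) - \<eta>x * (?g \<bullet> gbar t)"
    by (simp add: xbar_Suc power_mult_distrib)
  then have "2 * (Phi n f Y (xbar (Suc t)) - Phi n f Y (xbar t)) / \<eta>x
      \<le> 2 * (L * (1 + \<kappa>) * (\<eta>x\<^sup>2 * (norm (gbar t))\<^sup>2) - \<eta>x * (?g \<bullet> gbar t)) / \<eta>x"
    using etax_pos by (intro divide_right_mono mult_left_mono) auto
  also have "\<dots> = (2 * L * (1 + \<kappa>) * \<eta>x) * (norm (gbar t))\<^sup>2 - 2 * (?g \<bullet> gbar t)"
    using etax_pos by (simp add: field_simps power2_eq_square)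
  also have "\<dots> \<le> 1 / 2 * (norm (gbar t))\<^sup>2 - 2 * (?g \<bullet> gbar t)"
  proof -
    \<comment> \<open>Since \<kappa> \<ge> 1, the smoothness constant is at most
      \<open>2 * \<kappa> * L\<close>, so the coefficient is at most
      \<open>4 * \<kappa> * L * \<eta>x\<close>.\<close>
    have "L * \<eta>x * (1 + \<kappa>) \<le> L * \<eta>x * (2 * \<kappa>)"
      using L_pos etax_pos kappa_ge1 by (intro mult_left_mono) auto
    then have "2 * L * (1 + \<kappa>) * \<eta>x \<le> 1 / 2" using small by (simp add: algebra_simps)
    then show ?thesis by (intro diff_right_mono mult_right_mono) auto
  qed
  also have "2 * (?g \<bullet> gbar t) = (norm ?g)\<^sup>2 + (norm (gbar t))\<^sup>2 - (norm (?g - gbar t))\<^sup>2"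
    by (simp add: power2_norm_eq_inner inner_diff inner_commute)
  finally have "(norm ?g)\<^sup>2 \<le> 2 / \<eta>x * (Phi n f Y (xbar t) - Phi n f Y (xbar (Suc t)))
      + (norm (?g - gbar t))\<^sup>2 - (norm (gbar t))\<^sup>2 / 2"
    by (simp add: diff_divide_distrib right_diff_distrib)
  then have "real n * (norm ?g)\<^sup>2 \<le> real n * (2 / \<eta>x * (Phi n f Y (xbar t) - Phi n f Y (xbar (Suc t)))
      + (norm (?g - gbar t))\<^sup>2 - (norm (gbar t))\<^sup>2 / 2)"
    by (rule mult_left_mono) simp
  then show ?thesis using gradient_error[of t] by (simp add: v_def algebra_simps)
qed

text \<open>Summing \<open>descent\<close> telescopes \<Phi> and leaves \<open>- V / 2\<close>,
  which cancels the \<open>V / 2\<close> of \<open>accumulated_error_bound\<close>.\<close>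

lemma sum_gradient_bound:
  assumes small: "8 * \<kappa> * L * \<eta>x \<le> 1"
    and u1: "43200 * \<kappa>\<^sup>2 * L\<^sup>2 * u \<le> \<rho> ^ 4"
    and u2: "300 * L\<^sup>2 * \<kappa>\<^sup>2 * u \<le> a\<^sup>2"
    and u3: "100000 * L ^ 4 * \<kappa> ^ 4 * u\<^sup>2 \<le> a * \<rho> ^ 4"
  shows "real n * (\<Sum>t<T. (norm (grad\<Phi> (xbar t)))\<^sup>2)
    \<le> 2 * real n / \<eta>x * (Phi n f Y (xbar 0) - Phi n f Y (xbar T))
      + 600 * \<kappa>\<^sup>2 * L\<^sup>2 * q 0 / \<rho> + 16 * L\<^sup>2 * \<delta> 0 / a + 4800 * u * \<kappa>\<^sup>2 * L\<^sup>2 * r 0 / \<rho> ^ 3"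
proof -
  define Q R S V \<Delta> where "Q = (\<Sum>t<T. q t)" and "R = (\<Sum>t<T. r t)" and "S = (\<Sum>t<T. s t)"
    and "V = (\<Sum>t<T. v t)" and "\<Delta> = (\<Sum>t<T. \<delta> t)"
  note defs = Q_def R_def S_def V_def \<Delta>_def
  have "a * \<Delta> \<le> \<delta> 0 + (\<Sum>t<T. 2 * a * \<kappa>\<^sup>2 * q t + 3 / a * \<kappa>\<^sup>2 * u * v t - 7 / 9 * s t)"
    unfolding defs by (rule sum_contraction[where a = "\<delta>", OF \<delta>_step nonneg(4)])
  also have "(\<Sum>t<T. 2 * a * \<kappa>\<^sup>2 * q t + 3 / a * \<kappa>\<^sup>2 * u * v t - 7 / 9 * s t)
      = 2 * a * \<kappa>\<^sup>2 * Q + 3 / a * \<kappa>\<^sup>2 * u * V - 7 / 9 * S"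
    by (simp only: defs sum.distrib sum_subtractf sum_distrib_left)
  finally have 1: "a * \<Delta> + 7 / 9 * S \<le> \<delta> 0 + 2 * a * \<kappa>\<^sup>2 * Q + 3 / a * \<kappa>\<^sup>2 * u * V" by simp
  have "\<rho> / 2 * Q \<le> q 0 + (\<Sum>t<T. 2 / \<rho> * u * r t)"
    unfolding defs by (rule sum_contraction[where a = q, OF q_step nonneg(1)])
  then have 2: "\<rho> / 2 * Q \<le> q 0 + 2 / \<rho> * u * R" by (simp only: defs sum_distrib_left)
  have "\<rho> / 2 * R \<le> r 0 + (\<Sum>t<T. 4 * L\<^sup>2 / \<rho> * (4 * q t + 4 * u / \<rho> * r t + u * v t + s t))"
    unfolding defs by (rule sum_contraction[where a = r, OF r_step nonneg(2)])
  then have 3: "\<rho> / 2 * R \<le> r 0 + 4 * L\<^sup>2 / \<rho> * (4 * Q + 4 * u / \<rho> * R + u * V + S)"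
    by (simp only: defs sum.distrib sum_distrib_left[symmetric])
  have "2 * L\<^sup>2 * (Q + \<Delta>) \<le> 600 * \<kappa>\<^sup>2 * L\<^sup>2 * q 0 / \<rho> + 16 * L\<^sup>2 * \<delta> 0 / a
      + 4800 * u * \<kappa>\<^sup>2 * L\<^sup>2 * r 0 / \<rho> ^ 3 + V / 2"
    by (rule accumulated_error_bound[where R = R and S = S and V = V])
      (use L_pos kappa_ge1 a_bounds rho_bounds nonneg 1 2 3 u1 u2 u3 in \<open>auto simp: defs intro!: sum_nonneg\<close>)
  moreover have "real n * (\<Sum>t<T. (norm (grad\<Phi> (xbar t)))\<^sup>2)
      \<le> (\<Sum>t<T. 2 * real n / \<eta>x * (Phi n f Y (xbar t) - Phi n f Y (xbar (Suc t))) + 2 * L\<^sup>2 * (q t + \<delta> t) - v t / 2)"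
    unfolding sum_distrib_left by (intro sum_mono descent small)
  moreover have "\<dots> = 2 * real n / \<eta>x * (\<Sum>t<T. Phi n f Y (xbar t) - Phi n f Y (xbar (Suc t)))
      + 2 * L\<^sup>2 * (Q + \<Delta>) - V / 2"
    by (simp only: defs sum.distrib sum_subtractf sum_distrib_left[symmetric] sum_divide_distrib[symmetric])
  moreover have "(\<Sum>t<T. Phi n f Y (xbar t) - Phi n f Y (xbar (Suc t))) = Phi n f Y (xbar 0) - Phi n f Y (xbar T)"
    by (rule sum_lessThan_telescope')
  ultimately show ?thesis by simp
qed

end

section \<open>Stepsizes and rate\<close>

definition dgta_\<gamma> :: "real \<Rightarrow> real \<Rightarrow> real \<Rightarrow> real \<Rightarrow> real" where
  "dgta_\<gamma> \<kappa> L \<mu> \<rho> = 120 * sqrt 3 * \<kappa> * L / \<rho>\<^sup>2 + 72 * sqrt 6 * \<kappa>\<^sup>2 * (L + \<mu>) / sqrt \<rho>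
     + 110 * \<kappa> powr (5/4) * L / \<rho> powr (9/8)"

text \<open>Each summand of \<gamma> secures one smallness condition: \<open>A\<close> the bound on
  the consensus loop as well as the descent condition, \<open>B\<close> the bound by
  \<open>a\<^sup>2\<close>, and \<open>C\<close> the mixed bound. As all are positive, \<gamma>
  dominates each.\<close>

lemma dgta_stepsizes:
  fixes L \<mu> \<rho> :: real
  assumes \<mu>: "0 < \<mu>" "\<mu> \<le> L" and \<rho>: "0 < \<rho>" "\<rho> \<le> 1"
  defines "\<kappa> \<equiv> L / \<mu>"
  defines "\<gamma> \<equiv> dgta_\<gamma> \<kappa> L \<mu> \<rho>"
  defines "u \<equiv> (1 / \<gamma>)\<^sup>2" and "a \<equiv> sqrt \<rho> / (9 * (L + \<mu>)) * \<mu>"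
  shows "0 < \<gamma>" "8 * \<kappa> * L * (1 / \<gamma>) \<le> 1" "43200 * \<kappa>\<^sup>2 * L\<^sup>2 * u \<le> \<rho> ^ 4"
    "300 * L\<^sup>2 * \<kappa>\<^sup>2 * u \<le> a\<^sup>2" "100000 * L ^ 4 * \<kappa> ^ 4 * u\<^sup>2 \<le> a * \<rho> ^ 4"
proof -
  define A B C where "A = 120 * sqrt 3 * \<kappa> * L / \<rho>\<^sup>2" and "B = 72 * sqrt 6 * \<kappa>\<^sup>2 * (L + \<mu>) / sqrt \<rho>"
    and "C = 110 * \<kappa> powr (5/4) * L / \<rho> powr (9/8)"
  have L: "0 < L" using \<mu> by simp
  have \<kappa>: "1 \<le> \<kappa>" using \<mu> by (simp add: \<kappa>_def)
  have pos: "0 < A" "0 < B" "0 < C" using L \<kappa> \<mu> \<rho> by (auto simp: A_def B_def C_def)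
  have \<gamma>: "\<gamma> = A + B + C" by (simp add: \<gamma>_def dgta_\<gamma>_def A_def B_def C_def)
  show \<gamma>0: "0 < \<gamma>" using pos \<gamma> by simp
  have ge: "A \<le> \<gamma>" "B \<le> \<gamma>" "C \<le> \<gamma>" using pos \<gamma> by auto
  have A2: "A\<^sup>2 * \<rho> ^ 4 = 43200 * \<kappa>\<^sup>2 * L\<^sup>2"
    using \<rho> by (simp add: A_def power_mult_distrib power_divide power_mult[symmetric])
  have B2: "B\<^sup>2 * \<rho> = 31104 * \<kappa> ^ 4 * (L + \<mu>)\<^sup>2"
  proof -
    have "(\<kappa>\<^sup>2 * (L + \<mu>))\<^sup>2 = \<kappa> ^ 4 * (L + \<mu>)\<^sup>2"
      by (simp only: power_mult_distrib power_mult[symmetric]) simp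
    moreover have "B\<^sup>2 * \<rho> = 31104 * (\<kappa>\<^sup>2 * (L + \<mu>))\<^sup>2"
    proof -
      have "B = 72 * sqrt 6 * (\<kappa>\<^sup>2 * (L + \<mu>)) / sqrt \<rho>" by (simp only: B_def mult.assoc)
      then have "B\<^sup>2 = (72 * sqrt 6)\<^sup>2 * (\<kappa>\<^sup>2 * (L + \<mu>))\<^sup>2 / (sqrt \<rho>)\<^sup>2"
        by (simp only: power_mult_distrib power_divide)
      moreover have "(72 * sqrt 6)\<^sup>2 = (31104::real)" by (simp add: power_mult_distrib)
      ultimately show ?thesis using \<rho> by simp
    qed
    ultimately show ?thesis by (simp only: mult.assoc)
  qed
  \<comment> \<open>Fourth powers clear the exponents 5/4 and 9/8 into 5 and 9/2; the numeral is the
    fourth power of 110.\<close>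
  have C4: "C ^ 4 * (\<rho> ^ 4 * sqrt \<rho>) = 146410000 * \<kappa> ^ 5 * L ^ 4"
  proof -
    have "(\<kappa> powr (5/4)) ^ 4 = \<kappa> ^ 5"
      using \<kappa> by (simp add: powr_power)
    moreover have "(\<rho> powr (9/8)) ^ 4 = \<rho> powr (4 + 1/2)"
      using \<rho> by (simp add: powr_power)
    then have "(\<rho> powr (9/8)) ^ 4 = \<rho> ^ 4 * sqrt \<rho>"
      using \<rho> unfolding powr_add by (simp add: powr_half_sqrt)
    ultimately show ?thesis
      using \<rho> by (simp add: C_def power_mult_distrib power_divide)
  qed
  have ge2: "A\<^sup>2 \<le> \<gamma>\<^sup>2" "B\<^sup>2 \<le> \<gamma>\<^sup>2" "C ^ 4 \<le> \<gamma> ^ 4" using ge pos by (auto intro!: power_mono)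
  show "43200 * \<kappa>\<^sup>2 * L\<^sup>2 * u \<le> \<rho> ^ 4"
  proof -
    have "43200 * \<kappa>\<^sup>2 * L\<^sup>2 \<le> \<gamma>\<^sup>2 * \<rho> ^ 4"
      unfolding A2[symmetric] using ge2 \<rho> by (intro mult_right_mono) auto
    then show ?thesis using \<gamma>0 by (simp add: u_def power_divide field_simps)
  qed
  show "8 * \<kappa> * L * (1 / \<gamma>) \<le> 1"
  proof -
    have "1 \<le> sqrt 3" by simp
    then have "8 \<le> 120 * sqrt 3" by linarith
    then have "8 * (\<kappa> * L) * \<rho>\<^sup>2 \<le> 120 * sqrt 3 * (\<kappa> * L) * 1"
      using \<kappa> L \<rho> by (intro mult_mono) (auto simp: power_le_one)
    then have "8 * \<kappa> * L \<le> A" using \<rho> by (simp add: A_def field_simps)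
    then show ?thesis using ge \<gamma>0 by (simp add: field_simps)
  qed
  show "300 * L\<^sup>2 * \<kappa>\<^sup>2 * u \<le> a\<^sup>2"
  proof -
    \<comment> \<open>24300 is 300 * 81, where 81 is the square of the 9 in
      \<open>a\<close>.\<close>
    have "24300 * \<kappa> ^ 4 * (L + \<mu>)\<^sup>2 \<le> 31104 * \<kappa> ^ 4 * (L + \<mu>)\<^sup>2" by (intro mult_right_mono) auto
    also have "\<dots> \<le> \<gamma>\<^sup>2 * \<rho>"
      unfolding B2[symmetric] using ge2 \<rho> by (intro mult_right_mono) auto
    finally have *: "24300 * \<kappa> ^ 4 * (L + \<mu>)\<^sup>2 \<le> \<gamma>\<^sup>2 * \<rho>" .
    have a2: "a\<^sup>2 = \<rho> * \<mu>\<^sup>2 / (81 * (L + \<mu>)\<^sup>2)"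
      using \<rho> unfolding a_def power_mult_distrib power_divide by simp
    have Lk: "L = \<kappa> * \<mu>" using \<mu> by (simp add: \<kappa>_def)
    have "300 * L\<^sup>2 * \<kappa>\<^sup>2 = 300 * \<kappa> ^ 4 * \<mu>\<^sup>2"
      by (simp add: Lk power_mult_distrib power4_eq_xxxx power2_eq_square)
    then have "300 * L\<^sup>2 * \<kappa>\<^sup>2 * (81 * (L + \<mu>)\<^sup>2) = 24300 * \<kappa> ^ 4 * (L + \<mu>)\<^sup>2 * \<mu>\<^sup>2"
      by simp
    also have "\<dots> \<le> \<gamma>\<^sup>2 * \<rho> * \<mu>\<^sup>2" by (intro mult_right_mono *) auto
    finally have "300 * L\<^sup>2 * \<kappa>\<^sup>2 * (81 * (L + \<mu>)\<^sup>2) \<le> \<gamma>\<^sup>2 * (\<rho> * \<mu>\<^sup>2)" by (simp only: mult.assoc)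
    moreover have "0 < 81 * (L + \<mu>)\<^sup>2" "0 < \<gamma>\<^sup>2" using L \<mu> \<gamma>0 by auto
    ultimately show ?thesis unfolding a2 u_def power_divide by (simp add: divide_simps mult.commute)
  qed
  show "100000 * L ^ 4 * \<kappa> ^ 4 * u\<^sup>2 \<le> a * \<rho> ^ 4"
  proof -
    \<comment> \<open>The lower bound for \<open>a\<close> by
      \<open>sqrt \<rho> / (18 * \<kappa>)\<close> explains the exponents in \<open>C\<close>: it
      contributes the fifth factor \<kappa> and the extra \<open>sqrt \<rho>\<close> before fourth
      roots are taken.\<close>
    have "\<mu> / (L + \<mu>) = 1 / (\<kappa> + 1)" using \<mu> by (simp add: \<kappa>_def field_simps)
    also have "\<dots> \<ge> 1 / (2 * \<kappa>)" using \<kappa> by (intro divide_left_mono) auto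
    finally have "sqrt \<rho> / 9 * (1 / (2 * \<kappa>)) \<le> sqrt \<rho> / 9 * (\<mu> / (L + \<mu>))"
      using \<rho> by (intro mult_left_mono) auto
    then have a: "sqrt \<rho> / (18 * \<kappa>) \<le> a" by (simp add: a_def)
    have "100000 * L ^ 4 * \<kappa> ^ 4 * (18 * \<kappa>) = 1800000 * (\<kappa> ^ 5 * L ^ 4)"
      by (simp add: power_numeral_reduce)
    also have "\<dots> \<le> 146410000 * (\<kappa> ^ 5 * L ^ 4)" using L \<kappa> by (intro mult_right_mono) auto
    also have "\<dots> = C ^ 4 * (\<rho> ^ 4 * sqrt \<rho>)" by (simp add: C4)
    also have "\<dots> \<le> \<gamma> ^ 4 * (\<rho> ^ 4 * sqrt \<rho>)" using ge2 \<rho> by (intro mult_right_mono) auto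
    finally have "100000 * L ^ 4 * \<kappa> ^ 4 / \<gamma> ^ 4 \<le> sqrt \<rho> / (18 * \<kappa>) * \<rho> ^ 4"
      using \<gamma>0 \<kappa> by (simp add: field_simps)
    also have "\<dots> \<le> a * \<rho> ^ 4" using a \<rho> by (intro mult_right_mono) auto
    finally show ?thesis by (simp add: u_def power_divide power_mult[symmetric])
  qed
qed

text \<open>Since \<open>1 - lam \<le> \<rho>\<close>, replacing \<rho> by \<open>1 - lam\<close> in
  denominators only enlarges them termwise, and \<open>L + \<mu> \<le> 2 * L\<close> removes the
  remaining \<mu>.\<close>

lemma dgta_rate_bound:
  fixes L \<mu> lam \<Delta> D c0 g0 n T :: real
  assumes \<mu>: "0 < \<mu>" "\<mu> \<le> L" and lam: "0 \<le> lam" "lam < 1"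
    and nn: "0 \<le> \<Delta>" "0 \<le> c0" "0 \<le> g0" "0 < n" "0 < T"
  defines "\<rho> \<equiv> 1 - lam\<^sup>2"
  defines "\<kappa> \<equiv> L / \<mu>"
  defines "\<gamma> \<equiv> dgta_\<gamma> \<kappa> L \<mu> \<rho>"
  shows "2 * \<Delta> / (1 / \<gamma> * T) + 600 * \<kappa>\<^sup>2 * L\<^sup>2 * c0 / (n * \<rho> * T)
      + 16 * D\<^sup>2 * L\<^sup>2 / (sqrt \<rho> / (9 * (L + \<mu>)) * \<mu> * T)
      + 4800 * (1 / \<gamma>)\<^sup>2 * \<kappa>\<^sup>2 * L\<^sup>2 * g0 / (n * \<rho> ^ 3 * T)
    \<le> 1000 * (\<Delta> * \<kappa> * L / ((1 - lam)\<^sup>2 * T) + \<Delta> * \<kappa>\<^sup>2 * L / (sqrt (1 - lam) * T)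
      + \<Delta> * \<kappa> powr (5/4) * L / ((1 - lam) powr (9/8) * T)
      + \<kappa> * D\<^sup>2 * L\<^sup>2 / (sqrt (1 - lam) * T) + \<kappa>\<^sup>2 * L\<^sup>2 * c0 / (n * (1 - lam) * T) + g0 / (n * T))"
proof -
  define m where "m = 1 - lam"
  have m: "0 < m" using lam by (simp add: m_def)
  have "lam\<^sup>2 \<le> lam" using lam by (simp add: power2_eq_square mult_left_le)
  then have \<rho>: "m \<le> \<rho>" "\<rho> \<le> 1" "0 < \<rho>" using lam by (auto simp: \<rho>_def m_def)
  have L: "0 < L" using \<mu> by simp
  have \<kappa>: "1 \<le> \<kappa>" using \<mu> by (simp add: \<kappa>_def)
  note st = dgta_stepsizes[OF \<mu> \<rho>(3,2), folded \<kappa>_def, folded \<gamma>_def]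
  have T1: "2 * \<Delta> / (1 / \<gamma> * T) \<le> 1000 * (\<Delta> * \<kappa> * L / (m\<^sup>2 * T) + \<Delta> * \<kappa>\<^sup>2 * L / (sqrt m * T)
      + \<Delta> * \<kappa> powr (5/4) * L / (m powr (9/8) * T))"
  proof -
    have s3: "sqrt 3 \<le> 2" by (rule real_le_lsqrt) auto
    have s6: "sqrt 6 \<le> 3" by (rule real_le_lsqrt) auto
    have "120 * sqrt 3 * \<kappa> * L / \<rho>\<^sup>2 \<le> 120 * 2 * \<kappa> * L / m\<^sup>2"
      using s3 \<kappa> L \<rho> m by (intro frac_le mult_right_mono mult_left_mono power_mono) auto
    also have "\<dots> = 240 * (\<kappa> * L / m\<^sup>2)" by simp
    finally have 1: "120 * sqrt 3 * \<kappa> * L / \<rho>\<^sup>2 \<le> 240 * (\<kappa> * L / m\<^sup>2)" .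
    have "72 * sqrt 6 * \<kappa>\<^sup>2 * (L + \<mu>) / sqrt \<rho> \<le> 72 * 3 * \<kappa>\<^sup>2 * (2 * L) / sqrt m"
      using s6 \<kappa> L \<rho> m \<mu> by (intro frac_le mult_mono) auto
    also have "\<dots> = 432 * (\<kappa>\<^sup>2 * L / sqrt m)" by simp
    finally have 2: "72 * sqrt 6 * \<kappa>\<^sup>2 * (L + \<mu>) / sqrt \<rho> \<le> 432 * (\<kappa>\<^sup>2 * L / sqrt m)" .
    have "110 * \<kappa> powr (5/4) * L / \<rho> powr (9/8) \<le> 110 * \<kappa> powr (5/4) * L / m powr (9/8)"
      using \<kappa> L \<rho> m by (intro frac_le powr_mono2) auto
    also have "\<dots> = 110 * (\<kappa> powr (5/4) * L / m powr (9/8))" by simp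
    finally have 3: "110 * \<kappa> powr (5/4) * L / \<rho> powr (9/8) \<le> 110 * (\<kappa> powr (5/4) * L / m powr (9/8))" .
    have "0 \<le> \<kappa> * L / m\<^sup>2" "0 \<le> \<kappa>\<^sup>2 * L / sqrt m" "0 \<le> \<kappa> powr (5/4) * L / m powr (9/8)"
      using \<kappa> L m by auto
    \<comment> \<open>Doubling makes the three coefficients 480, 864 and 220, so 1000 covers all of
      them.\<close>
    with 1 2 3 have "2 * \<gamma> \<le> 1000 * (\<kappa> * L / m\<^sup>2 + \<kappa>\<^sup>2 * L / sqrt m + \<kappa> powr (5/4) * L / m powr (9/8))"
      unfolding \<gamma>_def dgta_\<gamma>_def by argo
    then have "\<Delta> / T * (2 * \<gamma>) \<le> \<Delta> / T * (1000 * (\<kappa> * L / m\<^sup>2 + \<kappa>\<^sup>2 * L / sqrt m + \<kappa> powr (5/4) * L / m powr (9/8)))"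
      using nn by (intro mult_left_mono) auto
    then show ?thesis by (simp add: distrib_left mult_ac)
  qed
  have T2: "600 * \<kappa>\<^sup>2 * L\<^sup>2 * c0 / (n * \<rho> * T) \<le> 1000 * (\<kappa>\<^sup>2 * L\<^sup>2 * c0 / (n * m * T))"
  proof -
    have "600 * \<kappa>\<^sup>2 * L\<^sup>2 * c0 / (n * \<rho> * T) \<le> 1000 * \<kappa>\<^sup>2 * L\<^sup>2 * c0 / (n * m * T)"
      using nn \<rho> m by (intro frac_le mult_right_mono mult_left_mono) auto
    then show ?thesis by (simp add: mult.assoc)
  qed
  have T3: "16 * D\<^sup>2 * L\<^sup>2 / (sqrt \<rho> / (9 * (L + \<mu>)) * \<mu> * T) \<le> 1000 * (\<kappa> * D\<^sup>2 * L\<^sup>2 / (sqrt m * T))"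
  proof -
    have "16 * D\<^sup>2 * L\<^sup>2 / (sqrt \<rho> / (9 * (L + \<mu>)) * \<mu> * T) = 144 * ((L + \<mu>) / \<mu>) * D\<^sup>2 * L\<^sup>2 / (sqrt \<rho> * T)"
      using L \<mu> by (simp add: mult_ac)
    also have "\<dots> \<le> 144 * (2 * \<kappa>) * D\<^sup>2 * L\<^sup>2 / (sqrt m * T)"
    proof (intro frac_le mult_right_mono mult_left_mono)
      show "(L + \<mu>) / \<mu> \<le> 2 * \<kappa>" using \<mu> by (simp add: \<kappa>_def field_simps)
    qed (use nn \<rho> m \<kappa> in auto)
    also have "\<dots> = 288 * (\<kappa> * D\<^sup>2 * L\<^sup>2 / (sqrt m * T))" by simp
    also have "\<dots> \<le> 1000 * (\<kappa> * D\<^sup>2 * L\<^sup>2 / (sqrt m * T))"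
      using nn m \<kappa> by (intro mult_right_mono) auto
    finally show ?thesis .
  qed
  have T4: "4800 * (1 / \<gamma>)\<^sup>2 * \<kappa>\<^sup>2 * L\<^sup>2 * g0 / (n * \<rho> ^ 3 * T) \<le> 1000 * (g0 / (n * T))"
  proof -
    \<comment> \<open>The first smallness condition bounds the coefficient by
      \<open>\<rho> ^ 4 / 9\<close>, which cancels the cube of \<rho> below the initial
      gradients.\<close>
    have "\<rho> ^ 4 \<le> \<rho> ^ 3" using \<rho> by (intro power_decreasing) auto
    moreover have "43200 * \<kappa>\<^sup>2 * L\<^sup>2 * (1 / \<gamma>)\<^sup>2 = 9 * (4800 * (1 / \<gamma>)\<^sup>2 * \<kappa>\<^sup>2 * L\<^sup>2)" by simp
    moreover have "0 \<le> 4800 * (1 / \<gamma>)\<^sup>2 * \<kappa>\<^sup>2 * L\<^sup>2" by simp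
    ultimately have "4800 * (1 / \<gamma>)\<^sup>2 * \<kappa>\<^sup>2 * L\<^sup>2 \<le> \<rho> ^ 3"
      using st(3) by linarith
    then have "4800 * (1 / \<gamma>)\<^sup>2 * \<kappa>\<^sup>2 * L\<^sup>2 / \<rho> ^ 3 \<le> 1"
      using \<rho> by (simp only: pos_divide_le_eq zero_less_power mult_1)
    then have "4800 * (1 / \<gamma>)\<^sup>2 * \<kappa>\<^sup>2 * L\<^sup>2 / \<rho> ^ 3 \<le> 1000" by (rule order_trans) simp
    then have "4800 * (1 / \<gamma>)\<^sup>2 * \<kappa>\<^sup>2 * L\<^sup>2 / \<rho> ^ 3 * (g0 / (n * T)) \<le> 1000 * (g0 / (n * T))"
      using nn \<rho> by (intro mult_right_mono) auto
    then show ?thesis by (simp add: mult_ac)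
  qed
  from T1 T2 T3 T4 show ?thesis unfolding m_def by (simp add: distrib_left)
qed

text \<open>Both bounds for fixed data. The parameters are variables tied by equations, so that the
  closed theorem, with all abbreviations expanded, is an instance by reflexivity.\<close>

lemma convergence_rate:
  fixes n d :: nat and p :: "nat \<Rightarrow> nat" and E W f G Y x0 y0
    and L \<mu> D \<Phi>min lam \<kappa> \<rho> \<gamma> \<eta>x \<eta>y :: real and T :: nat
  assumes n: "n \<ge> 1" and graph: "connected_graph n E" and matrix: "mixing_matrix n E W" and lam1: "lam < 1"
    and pos: "L > 0" "\<mu> > 0" "D > 0"
    and fns: "\<forall>i<n. is_gradient d (p i) (Y i) (f i) (G i) \<and> smooth_grad d (Y i) L (G i)
                 \<and> strongly_concave_y d (Y i) \<mu> (f i) (G i)"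
    and sets: "\<forall>i<n. Y i \<subseteq> euclid (p i) \<and> Y i \<noteq> {} \<and> convex (Y i) \<and> compact (Y i) \<and> diameter (Y i) = D"
    and lower: "\<forall>x\<in>euclid d. \<Phi>min \<le> Phi n f Y x"
    and init: "\<forall>i<n. x0 i \<in> euclid d \<and> y0 i \<in> Y i"
    and T: "T \<ge> 1"
    and lam: "lam = spectral_norm n (\<lambda>i j. W i j - 1 / real n)"
    and \<kappa>: "\<kappa> = L / \<mu>" and \<rho>: "\<rho> = 1 - lam\<^sup>2" and \<gamma>: "\<gamma> = dgta_\<gamma> \<kappa> L \<mu> \<rho>"
    and \<eta>x: "\<eta>x = 1 / \<gamma>" and \<eta>y: "\<eta>y = sqrt \<rho> / (9 * (L + \<mu>))"
  defines xbar: "xbar \<equiv> \<lambda>t. avg n (dgta_x E W Y G \<eta>x \<eta>y x0 y0 t)"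
  defines \<Delta>: "\<Delta> \<equiv> Phi n f Y (xbar 0) - \<Phi>min"
    and cons0: "cons0 \<equiv> (frob_norm n (\<lambda>i. x0 i - xbar 0))\<^sup>2"
    and grad0: "grad0 \<equiv> (\<Sum>i<n. (norm (fst (G i (x0 i, y0 i))))\<^sup>2)"
    and lhs: "lhs \<equiv> (1 / real T) * (\<Sum>t<T. (norm (gradient_on (euclid d) (Phi n f Y) (xbar t)))\<^sup>2)"
  shows "lhs \<le> 2 * \<Delta> / (\<eta>x * real T)
              + 600 * \<kappa>\<^sup>2 * L\<^sup>2 * cons0 / (real n * \<rho> * real T)
              + 16 * D\<^sup>2 * L\<^sup>2 / (\<eta>y * \<mu> * real T)
              + 4800 * \<eta>x\<^sup>2 * \<kappa>\<^sup>2 * L\<^sup>2 * grad0 / (real n * \<rho> ^ 3 * real T)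
        \<and> lhs \<le> 1000 * (\<Delta> * \<kappa> * L / ((1 - lam)\<^sup>2 * real T)
                  + \<Delta> * \<kappa>\<^sup>2 * L / (sqrt (1 - lam) * real T)
                  + \<Delta> * \<kappa> powr (5/4) * L / ((1 - lam) powr (9/8) * real T)
                  + \<kappa> * D\<^sup>2 * L\<^sup>2 / (sqrt (1 - lam) * real T)
                  + \<kappa>\<^sup>2 * L\<^sup>2 * cons0 / (real n * (1 - lam) * real T)
                  + grad0 / (real n * real T))"
    (is "lhs \<le> ?A \<and> lhs \<le> ?B")
proof -
  interpret network n E W by standard (rule n graph matrix)+
  have agents: "agent d (p i) (Y i) (f i) (G i) L \<mu>" if "i < n" for i
    using fns sets pos that by (simp add: agent_def)
  have lam0: "0 \<le> lam" unfolding lam by (rule spectral_norm_nonneg)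
  then have r: "0 < \<rho>" "\<rho> \<le> 1" using lam1 by (auto simp: \<rho> power_less_one_iff)
  have bnd: "norm (y - y') \<le> D" if "i < n" "y \<in> Y i" "y' \<in> Y i" for i y y'
    using diameter_bounded_bound[OF compact_imp_bounded, of "Y i" y y'] sets that by (simp add: dist_norm)
  have "\<mu> \<le> L"
  proof -
    have 0: "0 < n" using n by simp
    \<comment> \<open>Here the positive diameter enters: a singleton would have diameter 0.\<close>
    have "\<exists>y\<in>Y 0. \<exists>y'\<in>Y 0. y \<noteq> y'"
    proof (rule ccontr)
      assume "\<not> ?thesis"
      then have "norm (y - y') \<le> 0" if "y \<in> Y 0" "y' \<in> Y 0" for y y'
        using that by (metis diff_self norm_zero order_refl)
      then have "diameter (Y 0) \<le> 0" by (intro diameter_le) simp_all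
      then show False using sets 0 pos by simp
    qed
    then show ?thesis using agent.mu_le_L[OF agents[OF 0]] by blast
  qed
  note st = dgta_stepsizes[OF pos(2) this r, folded \<kappa>, folded \<gamma>, folded \<eta>x \<eta>y]
  interpret dgta_run n E W d p f G Y L \<mu> \<eta>x \<eta>y x0 y0
  proof (intro_locales, rule dgta_run_axioms.intro)
    show "spectral_norm n (\<lambda>i j. W i j - 1 / real n) < 1" using lam lam1 by simp
    show "\<eta>x > 0" using st(1) by (simp add: \<eta>x)
    show "\<eta>y > 0" using r pos by (simp add: \<eta>y)
    show "9 * \<eta>y * (L + \<mu>) \<le> 1"
    proof -
      have "9 * (b / (9 * c)) * c = b" if "c > 0" for b c :: real using that by simp
      from this[of "L + \<mu>"] show ?thesis using r pos by (simp only: \<eta>y) simp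
    qed
  qed (use agents \<open>\<mu> \<le> L\<close> init in auto)
  \<comment> \<open>The interpretation brings its own \<rho>, \<kappa> and \<open>xbar\<close>; they
    are identified with those of the statement.\<close>
  have \<rho>_eq: "dgta_run.\<rho> n W = \<rho>" by (simp add: \<rho>_def \<rho> lam)
  have \<kappa>_eq: "dgta_run.\<kappa> L \<mu> = \<kappa>" by (simp add: \<kappa>_def \<kappa>)
  have xbar_eq: "dgta_run.xbar n E W G Y \<eta>x \<eta>y x0 y0 = xbar"
    by (simp add: fun_eq_iff xbar xbar_def x_def)
  have lower': "\<Phi>min \<le> Phi n f Y (xbar T)" "0 \<le> \<Delta>"
    using lower xbar_in unfolding xbar_eq \<Delta> by auto
  have q0: "q 0 = cons0"
    unfolding cons0 frob_norm_def q_def deviation_def xbar_eq[symmetric] xbar_def x_0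
    by (simp add: sum_nonneg)
  have r0: "r 0 \<le> grad0"
    unfolding r_def g_0 grad0 using deviation_le[OF n, of "h 0"] by (simp add: h_def x_0 y_0)
  have d0: "\<delta> 0 \<le> real n * D\<^sup>2"
  proof -
    have "\<delta> 0 \<le> (\<Sum>i<n. D\<^sup>2)"
      unfolding \<delta>_def by (intro sum_mono power_mono bnd) (auto intro: y_in ys_in xbar_in)
    then show ?thesis by simp
  qed
  have "lhs = (1 / real T) * (\<Sum>t<T. (norm (grad\<Phi> (xbar t)))\<^sup>2)"
    unfolding lhs using gradient_Phi xbar_in by (simp add: xbar_eq)
  \<comment> \<open>The comparison is made after multiplication by \<open>n * T\<close>, the scale
    on which the recursions were summed.\<close>
  then have "lhs * (real n * real T) = real n * (\<Sum>t<T. (norm (grad\<Phi> (xbar t)))\<^sup>2)"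
    using T by simp
  also have "\<dots> \<le> 2 * real n / \<eta>x * (Phi n f Y (xbar 0) - Phi n f Y (xbar T))
      + 600 * \<kappa>\<^sup>2 * L\<^sup>2 * q 0 / \<rho> + 16 * L\<^sup>2 * \<delta> 0 / a + 4800 * u * \<kappa>\<^sup>2 * L\<^sup>2 * r 0 / \<rho> ^ 3"
    using sum_gradient_bound[of T] st(2-5) unfolding \<rho>_eq \<kappa>_eq xbar_eq u_def a_def by blast
  \<comment> \<open>The lower bound of \<Phi> replaces its last value, the diameter bounds
    \<open>\<delta> 0\<close>, and the full sum of squares bounds \<open>r 0\<close>.\<close>
  also have "\<dots> \<le> 2 * real n / \<eta>x * \<Delta>
      + 600 * \<kappa>\<^sup>2 * L\<^sup>2 * cons0 / \<rho> + 16 * L\<^sup>2 * (real n * D\<^sup>2) / a + 4800 * u * \<kappa>\<^sup>2 * L\<^sup>2 * grad0 / \<rho> ^ 3"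
    unfolding q0 using r a_bounds etax_pos nonneg(6) d0 r0 lower'
    by (intro add_mono divide_right_mono mult_left_mono order_refl) (auto simp: \<Delta>)
  also have "\<dots> = ?A * (real n * real T)"
    using n T r a_bounds etax_pos etay_pos mu_pos
    by (simp add: distrib_left distrib_right u_def a_def mult_ac)
  finally have A: "lhs \<le> ?A"
    using n T by (simp add: mult_le_cancel_right)
  have "?A \<le> ?B"
    using dgta_rate_bound[OF pos(2) \<open>\<mu> \<le> L\<close> lam0 lam1 lower'(2), of cons0 grad0 "real n" "real T" D] n T
    unfolding \<rho>[symmetric] \<kappa>[symmetric] \<gamma>[symmetric] \<eta>x[symmetric] \<eta>y[symmetric]
    by (simp add: cons0 grad0 sum_nonneg)
  with A show ?thesis by linarith
qed

theorem corollary4p1p1: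
  shows "\<exists>C::real. C > 0 \<and> (\<forall>(n::nat) (d::nat) (p :: nat \<Rightarrow> nat)
      E W f G Y (L::real) (\<mu>::real) (D::real) (\<Phi>min::real) x0 y0 (T::nat).
    (let lam = spectral_norm n (\<lambda>i j. W i j - 1 / real n);
         \<kappa> = L / \<mu>;
         \<gamma> = 120 * sqrt 3 * \<kappa> * L / (1 - lam\<^sup>2)\<^sup>2
             + 72 * sqrt 6 * \<kappa>\<^sup>2 * (L + \<mu>) / sqrt (1 - lam\<^sup>2)
             + 110 * \<kappa> powr (5/4) * L / (1 - lam\<^sup>2) powr (9/8);
         \<eta>x = 1 / \<gamma>;
         \<eta>y = sqrt (1 - lam\<^sup>2) / (9 * (L + \<mu>));
         \<Phi> = Phi n f Y;
         xbar = (\<lambda>t. avg n (dgta_x E W Y G \<eta>x \<eta>y x0 y0 t));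
         \<Delta> = \<Phi> (xbar 0) - \<Phi>min;
         cons0 = (frob_norm n (\<lambda>i. x0 i - xbar 0))\<^sup>2;
         grad0 = (\<Sum>i<n. (norm (fst (G i (x0 i, y0 i))))\<^sup>2);
         lhs = (1 / real T) * (\<Sum>t<T. (norm (gradient_on (euclid d) \<Phi> (xbar t)))\<^sup>2)
     in n \<ge> 1 \<and> connected_graph n E \<and> mixing_matrix n E W \<and> lam < 1
        \<and> L > 0 \<and> \<mu> > 0 \<and> D > 0
        \<and> (\<forall>i<n. is_gradient d (p i) (Y i) (f i) (G i)
                 \<and> smooth_grad d (Y i) L (G i)
                 \<and> strongly_concave_y d (Y i) \<mu> (f i) (G i))
        \<and> (\<forall>i<n. Y i \<subseteq> euclid (p i) \<and> Y i \<noteq> {} \<and> convex (Y i) \<and> compact (Y i)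
                 \<and> diameter (Y i) = D)
        \<and> (\<forall>x\<in>euclid d. \<Phi>min \<le> \<Phi> x)
        \<and> (\<forall>i<n. x0 i \<in> euclid d \<and> y0 i \<in> Y i)
        \<and> T \<ge> 1
      \<longrightarrow>
        lhs \<le> 2 * \<Delta> / (\<eta>x * real T)
              + 600 * \<kappa>\<^sup>2 * L\<^sup>2 * cons0 / (real n * (1 - lam\<^sup>2) * real T)
              + 16 * D\<^sup>2 * L\<^sup>2 / (\<eta>y * \<mu> * real T)
              + 4800 * \<eta>x\<^sup>2 * \<kappa>\<^sup>2 * L\<^sup>2 * grad0 / (real n * (1 - lam\<^sup>2) ^ 3 * real T)
        \<and>
        lhs \<le> C * (\<Delta> * \<kappa> * L / ((1 - lam)\<^sup>2 * real T)
                  + \<Delta> * \<kappa>\<^sup>2 * L / (sqrt (1 - lam) * real T)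
                  + \<Delta> * \<kappa> powr (5/4) * L / ((1 - lam) powr (9/8) * real T)
                  + \<kappa> * D\<^sup>2 * L\<^sup>2 / (sqrt (1 - lam) * real T)
                  + \<kappa>\<^sup>2 * L\<^sup>2 * cons0 / (real n * (1 - lam) * real T)
                  + grad0 / (real n * real T))))"
  unfolding Let_def dgta_\<gamma>_def[symmetric]
\<comment> \<open>1000 is the constant of \<open>dgta_rate_bound\<close>, chosen before any problem
  data.\<close>
proof (rule exI[of _ 1000], rule conjI, simp, intro allI impI, elim conjE)
qed (rule convergence_rate[OF _ _ _ _ _ _ _ _ _ _ _ _ refl refl refl refl refl refl], assumption+)

end
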